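(* For every planar graph $G$, $\chi^\star_c(G)\le 8$.
   Context: Graphs are finite and simple. For a positive integer $k$, a $k$-cover (or $k$-correspondence assignment) of a graph $G$ is a pair $(\vec D,\sigma)$ where $\vec D$ is an orientation of $G$ and $\sigma$ assigns to each arc of $\vec D$ a permutation of $[k]=\{1,\dots,k\}$. A $(\vec D,\sigma)$-coloring is a map $\varphi:V(G)\to[k]$ with $\sigma(vw)(\varphi(v))\ne\varphi(w)$ for every arc $vw$ of $\vec D$. A $(\vec D,\sigma)$-packing is a collection $\varphi_1,\dots,\varphi_k$ of $(\vec D,\sigma)$-colorings such that $\varphi_i(v)\ne\varphi_j(v)$ for every vertex $v$ and all distinct $i,j\in[k]$. The correspondence packing number $\chi^\star_c(G)$ is the minimum $k$ such that $G$ has a $(\vec D,\sigma)$-packing for every $k$-cover $(\vec D,\sigma)$ of $G$. *)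

theory Defs
  imports
    "HOL-Analysis.Analysis"
    "HOL-Combinatorics.Permutations"
    "HOL-Library.Extended_Nat"
    "Graph_Theory.Pair_Digraph"
begin

text \<open>
  A finite simple graph is a \<^locale>\<open>pair_graph\<close>: the edge \<open>uv\<close> is represented by the two pairs
  \<open>(u, v)\<close> and \<open>(v, u)\<close>.
\<close>

text \<open>
  The curve \<open>\<gamma> {u, v}\<close> is indexed by the unordered edge, so that \<open>(u, v)\<close> and \<open>(v, u)\<close> share a
  single curve in the drawing.
\<close>
definition plane_drawing ::
    "'a pair_pre_digraph \<Rightarrow> ('a \<Rightarrow> complex) \<Rightarrow> ('a set \<Rightarrow> real \<Rightarrow> complex) \<Rightarrow> bool" where
  "plane_drawing G p \<gamma> \<longleftrightarrow>
     inj_on p (pverts G) \<and>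
     (\<forall>(u, v) \<in> parcs G.
        arc (\<gamma> {u, v}) \<and>
        {pathstart (\<gamma> {u, v}), pathfinish (\<gamma> {u, v})} = {p u, p v} \<and>
        path_image (\<gamma> {u, v}) \<inter> p ` pverts G = {p u, p v}) \<and>
     (\<forall>(u, v) \<in> parcs G. \<forall>(x, y) \<in> parcs G. {u, v} \<noteq> {x, y} \<longrightarrow>
        path_image (\<gamma> {u, v}) \<inter> path_image (\<gamma> {x, y}) \<subseteq> p ` pverts G)"

definition planar :: "'a pair_pre_digraph \<Rightarrow> bool" where
  "planar G \<longleftrightarrow> (\<exists>p \<gamma>. plane_drawing G p \<gamma>)"

definition orientation :: "'a pair_pre_digraph \<Rightarrow> 'a rel \<Rightarrow> bool" where
  "orientation G D \<longleftrightarrow>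
     D \<subseteq> parcs G \<and> (\<forall>(u, v) \<in> parcs G. (u, v) \<in> D \<longleftrightarrow> (v, u) \<notin> D)"

definition cover ::
    "nat \<Rightarrow> 'a pair_pre_digraph \<Rightarrow> 'a rel \<Rightarrow> ('a \<times> 'a \<Rightarrow> nat \<Rightarrow> nat) \<Rightarrow> bool" where
  "cover k G D \<sigma> \<longleftrightarrow> orientation G D \<and> (\<forall>a \<in> D. \<sigma> a permutes {1..k})"

definition cover_coloring ::
    "nat \<Rightarrow> 'a pair_pre_digraph \<Rightarrow> 'a rel \<Rightarrow> ('a \<times> 'a \<Rightarrow> nat \<Rightarrow> nat) \<Rightarrow> ('a \<Rightarrow> nat) \<Rightarrow> bool" where
  "cover_coloring k G D \<sigma> \<phi> \<longleftrightarrow>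
     (\<forall>v \<in> pverts G. \<phi> v \<in> {1..k}) \<and> (\<forall>(v, w) \<in> D. \<sigma> (v, w) (\<phi> v) \<noteq> \<phi> w)"

definition cover_packing ::
    "nat \<Rightarrow> 'a pair_pre_digraph \<Rightarrow> 'a rel \<Rightarrow> ('a \<times> 'a \<Rightarrow> nat \<Rightarrow> nat) \<Rightarrow> (nat \<Rightarrow> 'a \<Rightarrow> nat) \<Rightarrow> bool" where
  "cover_packing k G D \<sigma> \<phi> \<longleftrightarrow>
     (\<forall>i \<in> {1..k}. cover_coloring k G D \<sigma> (\<phi> i)) \<and>
     (\<forall>v \<in> pverts G. \<forall>i \<in> {1..k}. \<forall>j \<in> {1..k}. i \<noteq> j \<longrightarrow> \<phi> i v \<noteq> \<phi> j v)"

text \<open>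
  The minimum is taken in \<^typ>\<open>enat\<close>, so that it would be \<open>\<infinity>\<close>, not an unspecified number, if no
  \<open>k\<close> qualified.
\<close>
definition correspondence_packing_number :: "'a pair_pre_digraph \<Rightarrow> enat" where
  "correspondence_packing_number G =
     Inf {enat k | k. k > 0 \<and> (\<forall>D \<sigma>. cover k G D \<sigma> \<longrightarrow> (\<exists>\<phi>. cover_packing k G D \<sigma> \<phi>))}"

end

theory Submission
  imports Defs
begin

text \<open>
  Packings are extended one vertex at a time, through perfect matchings between the eight indices and
  the eight colours. A vertex of degree at most \<open>4\<close> is added by Hall's theorem. For a vertex \<open>v\<close> of
  degree \<open>5\<close> with a neighbour \<open>w\<close> of degree at most \<open>6\<close>, either Hall's condition holds at \<open>v\<close> or it
  is violated by a \<open>4 \<times> 5\<close> rectangle, which determines the matching at \<open>w\<close> almost completely on four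
  rows; the matching at \<open>w\<close> has enough alternating cycles to be changed there, which unblocks \<open>v\<close>.

  One of the two configurations always occurs. Otherwise the set \<open>I\<close> of vertices of degree \<open>5\<close> sends
  all its edges to the set \<open>H\<close> of vertices of degree at least \<open>7\<close>. The bound \<open>3n - 3\<close> on the number
  of edges of a planar graph gives \<open>card H < card I\<close>, while the bound \<open>2n - 2\<close> for the bipartite
  planar graph between \<open>I\<close> and \<open>H\<close> gives \<open>3 * card I < 2 * card H\<close>.

  Both edge bounds follow from the Jordan curve theorem, which provides many faces, and from counting
  pairs of a face and an edge on its frontier. An edge borders at most two faces: if \<open>x\<close>, \<open>y\<close>, \<open>z\<close>
  lay in three faces along one edge, some product of integer powers of \<open>w - x\<close>, \<open>w - y\<close>, \<open>w - z\<close>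
  would have a continuous logarithm on the drawing, contrary to a winding number argument.
\<close>

section \<open>Edges of plane graphs\<close>

text \<open>With eight colours, four neighbours are harmless: every index loses at most four colours
  and every colour at most four indices, and half of eight is enough for Hall. A planar graph may
  have minimum degree five, where only three choices per row remain guaranteed. Hence
  \<open>w\<close> is freed together with \<open>v\<close>: apart from each other they have four and
  at most five coloured neighbours, which leaves 4 and 3 choices per row and column. Once the
  colours of \<open>w\<close> are transported along the edge to the palette of \<open>v\<close>, the
  edge asks only that two matchings be disjoint. The packing without \<open>v\<close> already
  supplies one matching at \<open>w\<close>, and 3 - 1 = 2 bounds from below the degrees in the
  digraph of its exchanges. Edges are drawn as arbitrary arcs, so there is no local picture with two
  sides of an edge; this is why even the statement about two faces per edge needs
  logarithms.\<close>

lemma continuous_log_quotient_if_connected_component: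
  fixes K :: "complex set"
  assumes "closed K" "connected_component (- K) a b"
  obtains g where "continuous_on K g" "\<And>w. w \<in> K \<Longrightarrow> exp (g w) = (w - a) / (w - b)"
proof -
  define R where
    "R x y \<longleftrightarrow> (\<exists>g. continuous_on K g \<and> (\<forall>w\<in>K. exp (g w) = (w - x) / (w - y)))" for x y
  let ?U = "connected_component_set (- K) a"
  have U: "?U \<subseteq> - K"
    by (rule connected_component_subset)
  have "R a b"
  proof (rule connected_equivalence_relation[of ?U])
    show "a \<in> ?U" "b \<in> ?U"
      using assms(2) connected_component_in by fastforce+
    fix x y z assume "R x y" "R y z" "x \<in> ?U" "y \<in> ?U" "z \<in> ?U"
    then obtain f g where f: "continuous_on K f" "\<forall>w\<in>K. exp (f w) = (w - x) / (w - y)"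
      and g: "continuous_on K g" "\<forall>w\<in>K. exp (g w) = (w - y) / (w - z)"
      unfolding R_def by blast
    have "y \<notin> K" using U \<open>y \<in> ?U\<close> by blast
    then show "R x z"
      unfolding R_def using f g
      by (intro exI[of _ "\<lambda>w. f w + g w"]) (auto simp: exp_add intro!: continuous_intros)
  next
    fix x y assume "R x y"
    then obtain f where f: "continuous_on K f" "\<forall>w\<in>K. exp (f w) = (w - x) / (w - y)"
      unfolding R_def by blast
    then show "R y x"
      unfolding R_def
      by (intro exI[of _ "\<lambda>w. - f w"]) (auto simp: exp_minus intro!: continuous_intros)
  next
    fix c assume "c \<in> ?U"
    then have "c \<in> - K" using U by blast
    have "open ?U" using assms(1) by (simp add: open_Compl open_connected_component)
    then obtain d where d: "d > 0" "ball c d \<subseteq> ?U"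
      using \<open>c \<in> ?U\<close> open_contains_ball by blast
    \<comment> \<open>Every point of \<open>K\<close> is farther from \<open>c\<close> than
      \<open>x\<close> is, so \<open>(w - x) / (w - c)\<close> stays in the right half-plane, where
      the principal logarithm is continuous. Thus \<open>R\<close> holds locally, and connectedness
      spreads it over the component.\<close>
    have "R c x" if "x \<in> ball c d" for x
    proof -
      have "Re ((w - x) / (w - c)) > 0 \<and> w \<noteq> c \<and> w \<noteq> x" if "w \<in> K" for w
      proof -
        have "w \<notin> ball c d" using that d U by blast
        then have "dist c x < dist c w" using \<open>x \<in> ball c d\<close> by auto
        then have n: "cmod (c - x) < cmod (w - c)" by (simp add: dist_norm norm_minus_commute)
        then have 1: "w \<noteq> c" by auto
        have 2: "w \<noteq> x" using n by (auto simp: norm_minus_commute)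
        let ?u = "(c - x) / (w - c)"
        have "cmod ?u < 1" using n by (simp add: norm_divide divide_simps)
        then have "\<bar>Re ?u\<bar> < 1"
          using abs_Re_le_cmod[of ?u] by linarith
        then have "Re (1 + ?u) > 0" by simp
        moreover have "1 + ?u = (w - x) / (w - c)"
          using 1 by (simp add: field_simps)
        ultimately show ?thesis using 1 2 by simp
      qed
      then show ?thesis
        unfolding R_def
        by (intro exI[of _ "\<lambda>w. - Ln ((w - x) / (w - c))"])
           (fastforce intro!: continuous_intros simp: complex_nonpos_Reals_iff exp_minus)
    qed
    then show "\<exists>T. openin (top_of_set ?U) T \<and> c \<in> T \<and> (\<forall>x\<in>T. R c x)"
      using d by (intro exI[of _ "ball c d"]) (auto intro: open_subset)
  qed simp
  then show ?thesis unfolding R_def using that by blast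
qed

text \<open>A winding number argument: along the circle the logarithm would have to grow by
  \<open>2 * pi * n\<close> times the imaginary unit, yet it returns to its initial value.\<close>

lemma not_continuous_log_powi_sphere:
  fixes x :: complex
  assumes "r > 0" "n \<noteq> 0" "continuous_on (sphere x r) l"
    and l: "\<And>w. w \<in> sphere x r \<Longrightarrow> (w - x) powi n = exp (l w)"
  shows False
proof -
  define c where "c \<theta> = x + of_real r * exp (\<i> * of_real \<theta>)" for \<theta> :: real
  \<comment> \<open>Subtracting the expected growth leaves a logarithm of the constant
    \<open>r powi n\<close>; its possible values are \<open>2 * pi\<close> apart, so it is
    constant.\<close>
  define m where "m \<theta> = l (c \<theta>) - of_int n * \<i> * of_real \<theta>" for \<theta> :: real
  have c: "c \<theta> \<in> sphere x r" for \<theta>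
    using \<open>r > 0\<close> by (simp add: c_def dist_norm norm_mult)
  have contc: "continuous_on {0..2*pi} c"
    unfolding c_def by (intro continuous_intros)
  have "continuous_on {0..2*pi} (l \<circ> c)"
    by (rule continuous_on_compose[OF contc]) (meson assms(3) c continuous_on_subset image_subsetI)
  then have contm: "continuous_on {0..2*pi} m"
    unfolding m_def by (auto intro!: continuous_intros simp: o_def)
  have em: "exp (m \<theta>) = of_real r powi n" for \<theta>
  proof -
    have "exp (l (c \<theta>)) = of_real r powi n * exp (of_int n * (\<i> * of_real \<theta>))"
      using l[OF c[of \<theta>]] by (simp add: c_def power_int_mult_distrib exp_power_int)
    then show ?thesis by (simp add: m_def exp_diff mult.assoc)
  qed
  have "m constant_on {0..2*pi}"
  proof (rule continuous_discrete_range_constant[OF _ contm])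
    fix s :: real assume "s \<in> {0..2*pi}"
    have "2*pi \<le> cmod (m t - m s)" if "m t \<noteq> m s" for t
    proof (rule ccontr)
      assume "\<not> ?thesis"
      then have "\<bar>Im (m t) - Im (m s)\<bar> < 2 * pi"
        using abs_Im_le_cmod[of "m t - m s"] by simp
      then have "m t = m s"
        by (rule exp_complex_eqI) (simp only: em)
      then show False using that by simp
    qed
    then show "\<exists>e>0. \<forall>t. t \<in> {0..2*pi} \<and> m t \<noteq> m s \<longrightarrow> e \<le> norm (m t - m s)"
      by (intro exI[of _ "2*pi"]) auto
  qed auto
  then have "m 0 = m (2*pi)"
    unfolding constant_on_def by fastforce
  moreover have "c 0 = c (2*pi)"
    using exp_two_pi_i by (simp add: c_def mult.commute)
  ultimately show False using \<open>n \<noteq> 0\<close> by (simp add: m_def)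
qed

text \<open>Borsuk's argument: Tietze extends the logarithm on \<open>K\<close>, so the function can
  be refilled without zeros inside the component while it stays \<open>(w - x) powi n\<close>
  outside. A logarithm of the result on a large disc contradicts the winding number. The factor
  \<open>k\<close> makes room for powers belonging to points outside \<open>K\<close> and the
  component.\<close>

lemma not_continuous_log_powi_bounded_component:
  fixes K :: "complex set"
  assumes "compact K" "x \<notin> K" "bounded (connected_component_set (- K) x)" "n \<noteq> 0"
    and G: "continuous_on K G"
    and k: "continuous_on (K \<union> connected_component_set (- K) x) k"
      "\<And>w. w \<in> K \<union> connected_component_set (- K) x \<Longrightarrow> k w \<noteq> 0"
    and eq: "\<And>w. w \<in> K \<Longrightarrow> exp (G w) = (w - x) powi n * k w"
  shows False
proof -
  let ?W = "connected_component_set (- K) x"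
  have clK: "closed K" using \<open>compact K\<close> by (rule compact_imp_closed)
  have xW: "x \<in> ?W" using \<open>x \<notin> K\<close> by (simp add: connected_component_refl)
  have oW: "open ?W" using clK by (simp add: open_Compl open_connected_component)
  have frW: "closure ?W \<subseteq> ?W \<union> K"
  proof -
    have "frontier ?W \<subseteq> frontier (- K)"
      using frontier_of_connected_component_subset by blast
    also have "\<dots> \<subseteq> K" using clK by (simp add: frontier_subset_closed)
    finally show ?thesis by (auto simp: frontier_def interior_open[OF oW])
  qed
  obtain B where B: "B \<ge> 0" "\<And>w. w \<in> K \<Longrightarrow> norm (G w) \<le> B"
  proof -
    have "bounded (G ` K)"
      using G \<open>compact K\<close> compact_continuous_image compact_imp_bounded by blast
    then obtain B where "\<And>w. w \<in> K \<Longrightarrow> norm (G w) \<le> B" unfolding bounded_iff by blast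
    then show ?thesis using that[of "max 0 B"] by fastforce
  qed
  obtain H where H: "continuous_on UNIV H" "\<And>w. w \<in> K \<Longrightarrow> H w = G w"
    using Tietze[OF G, of UNIV B] B clK by (metis closed_closedin subtopology_UNIV)
  define F where "F w = (if w \<in> ?W then exp (H w) / k w else (w - x) powi n)" for w
  have contF: "continuous_on (closure ?W \<union> - ?W) F"
    unfolding F_def
  proof (rule continuous_on_cases)
    show "closed (closure ?W)" "closed (- ?W)" using oW by auto
    show "continuous_on (closure ?W) (\<lambda>w. exp (H w) / k w)"
      by (intro continuous_intros continuous_on_subset[OF H(1)] continuous_on_subset[OF k(1)])
         (use frW k(2) in auto)
    show "continuous_on (- ?W) (\<lambda>w. (w - x) powi n)"
      by (intro continuous_intros) (use xW in auto)
    show "\<forall>w. w \<in> closure ?W \<and> w \<notin> ?W \<or> w \<in> - ?W \<and> w \<in> ?W \<longrightarrow> exp (H w) / k w = (w - x) powi n"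
    proof (intro allI impI)
      fix w assume "w \<in> closure ?W \<and> w \<notin> ?W \<or> w \<in> - ?W \<and> w \<in> ?W"
      then have "w \<in> K" using frW by blast
      then show "exp (H w) / k w = (w - x) powi n"
        using eq[of w] H(2)[of w] k(2)[of w] by simp
    qed
  qed
  have UN: "closure ?W \<union> - ?W = UNIV" using closure_subset by blast
  have F0: "F w \<noteq> 0" for w
    using k(2)[of w] xW by (auto simp: F_def power_int_eq_0_iff)
  obtain r where r: "r > 0" "?W \<subseteq> ball x r"
    using bounded_subset_ballD[OF assms(3), of x] by blast
  obtain l where l: "continuous_on (cball x r) l" "\<And>w. w \<in> cball x r \<Longrightarrow> F w = exp (l w)"
    by (rule continuous_logarithm_on_cball[of x r F])
       (use contF UN F0 in \<open>auto intro: continuous_on_subset\<close>)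
  show False
  proof (rule not_continuous_log_powi_sphere[OF r(1) \<open>n \<noteq> 0\<close>])
    show "continuous_on (sphere x r) l"
      using l(1) continuous_on_subset sphere_cball by blast
    fix w assume w: "w \<in> sphere x r"
    then have "w \<notin> ?W" using r by auto
    then show "(w - x) powi n = exp (l w)"
      using l(2)[of w] w by (simp add: F_def)
  qed
qed

text \<open>Converse of \<open>continuous_log_quotient_if_connected_component\<close> for compact
  \<open>K\<close>: only one component is unbounded, so \<open>y\<close> or \<open>z\<close> lies in
  a bounded one, and the two are symmetric up to the sign of the logarithm.\<close>

lemma not_continuous_log_quotient:
  fixes K :: "complex set"
  assumes "compact K" "y \<notin> K" "z \<notin> K" "\<not> connected_component (- K) y z"
    and "continuous_on K g" "\<And>w. w \<in> K \<Longrightarrow> exp (g w) = (w - y) / (w - z)"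
  shows False
proof -
  have *: False
    if "u \<notin> K" "v \<notin> K" "\<not> connected_component (- K) u v" "bounded (connected_component_set (- K) u)"
      "continuous_on K h" "\<And>w. w \<in> K \<Longrightarrow> exp (h w) = (w - u) / (w - v)" for u v h
  proof (rule not_continuous_log_powi_bounded_component[of K u 1 h "\<lambda>w. 1 / (w - v)"])
    have v: "v \<notin> K \<union> connected_component_set (- K) u" using that by auto
    show "continuous_on (K \<union> connected_component_set (- K) u) (\<lambda>w. 1 / (w - v))"
      using v by (auto intro!: continuous_intros)
    show "1 / (w - v) \<noteq> 0" if "w \<in> K \<union> connected_component_set (- K) u" for w
      using v that by auto
  qed (use that assms in auto)
  have "bounded (connected_component_set (- K) y) \<or> bounded (connected_component_set (- K) z)"
  proof (rule ccontr)
    assume "\<not> ?thesis"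
    then have "connected_component_set (- K) y = connected_component_set (- K) z"
      by (intro cobounded_unique_unbounded_component) (use assms compact_imp_bounded in auto)
    then have "z \<in> connected_component_set (- K) y"
      using \<open>z \<notin> K\<close> by (metis ComplI connected_component_refl mem_Collect_eq)
    then show False using assms by simp
  qed
  then show False
  proof
    assume "bounded (connected_component_set (- K) y)"
    then show False using *[of y z g] assms by blast
  next
    assume "bounded (connected_component_set (- K) z)"
    moreover have "\<not> connected_component (- K) z y"
      using assms(4) connected_component_sym by blast
    moreover have "continuous_on K (\<lambda>w. - g w)"
      using assms(5) by (intro continuous_intros)
    moreover have "exp (- g w) = (w - z) / (w - y)" if "w \<in> K" for w
      using assms(6)[OF that] by (simp add: exp_minus)
    ultimately show False using *[of z y "\<lambda>w. - g w"] assms by blast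
  qed
qed

text \<open>On \<open>K\<close> and on the arc separately, both \<open>(w - x) / (w - z)\<close> and
  \<open>(w - y) / (w - z)\<close> have logarithms. Once matched at \<open>a\<close>, each has one
  integer mismatch at \<open>b\<close>, and two integers always satisfy a nontrivial linear
  relation, so some combination glues over the union. A third component would forbid that.\<close>

lemma complement_arc_at_most_two_components:
  fixes K :: "complex set"
  assumes "compact K" "arc \<gamma>" and ends: "K \<inter> path_image \<gamma> \<subseteq> {a, b}"
    and same: "connected_component (- K) x z" "connected_component (- K) y z"
    and notin: "x \<notin> path_image \<gamma>" "y \<notin> path_image \<gamma>" "z \<notin> path_image \<gamma>"
    and xy: "\<not> connected_component (- (K \<union> path_image \<gamma>)) x y"
    and xz: "\<not> connected_component (- (K \<union> path_image \<gamma>)) x z"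
    and yz: "\<not> connected_component (- (K \<union> path_image \<gamma>)) y z"
  shows False
proof -
  let ?E = "path_image \<gamma>"
  let ?C = "\<lambda>u. connected_component_set (- (K \<union> ?E)) u"
  have cE: "compact ?E" using \<open>arc \<gamma>\<close> by (rule compact_arc_image)
  have cKE: "compact (K \<union> ?E)" using assms(1) cE by (rule compact_Un)
  have notK: "x \<notin> K" "y \<notin> K" "z \<notin> K"
    using same connected_component_in by blast+
  have main: False
    if same: "connected_component (- K) x z" "connected_component (- K) y z"
      and notin: "x \<notin> ?E" "y \<notin> ?E" "z \<notin> ?E" "x \<notin> K" "y \<notin> K" "z \<notin> K"
      and xy: "\<not> connected_component (- (K \<union> ?E)) x y"
      and xz: "\<not> connected_component (- (K \<union> ?E)) x z"
      and yz: "\<not> connected_component (- (K \<union> ?E)) y z"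
      and bx: "bounded (?C x)" for x y z
  proof -
    \<comment> \<open>After normalising at \<open>a\<close>, the integer \<open>n\<close> at
      \<open>b\<close> is the sole obstruction to gluing; an end that is not in \<open>K\<close>
      imposes no condition.\<close>
    have "\<exists>g h. \<exists>n::int. continuous_on K g \<and> continuous_on ?E h \<and>
        (\<forall>w\<in>K. exp (g w) = (w - u) / (w - z)) \<and> (\<forall>w\<in>?E. exp (h w) = (w - u) / (w - z)) \<and>
        (a \<in> K \<inter> ?E \<longrightarrow> h a = g a) \<and> (b \<in> K \<inter> ?E \<longrightarrow> h b = g b + 2 * of_int n * of_real pi * \<i>)"
      if u: "connected_component (- K) u z" "u \<notin> ?E" "u \<notin> K" for u
    proof -
      obtain g where g: "continuous_on K g" "\<And>w. w \<in> K \<Longrightarrow> exp (g w) = (w - u) / (w - z)"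
        using continuous_log_quotient_if_connected_component[OF compact_imp_closed[OF assms(1)] u(1)]
        by metis
      have "connected (- ?E)" by (rule connected_arc_complement[OF \<open>arc \<gamma>\<close>]) simp
      then have "connected_component (- ?E) u z"
        using u notin unfolding connected_iff_connected_component by blast
      then obtain h where h: "continuous_on ?E h" "\<And>w. w \<in> ?E \<Longrightarrow> exp (h w) = (w - u) / (w - z)"
        using continuous_log_quotient_if_connected_component[OF compact_imp_closed[OF cE]] by metis
      have ex: "\<exists>n::int. h w = g w + 2 * of_int n * of_real pi * \<i>" if "w \<in> K \<inter> ?E" for w
        using that g(2)[of w] h(2)[of w] exp_eq[of "h w" "g w"] by auto
      show ?thesis
      proof (cases "a \<in> K \<inter> ?E")
        case True
        then obtain m :: int where m: "h a = g a + 2 * of_int m * of_real pi * \<i>" using ex by blast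
        obtain n :: int where n: "b \<in> K \<inter> ?E \<longrightarrow> h b = g b + 2 * of_int n * of_real pi * \<i>"
          using ex by blast
        let ?c = "2 * of_int m * of_real pi * \<i> :: complex"
        have "exp ?c = 1" unfolding exp_eq_1 by simp
        then show ?thesis using g h m n
          by (intro exI[of _ g] exI[of _ "\<lambda>w. h w - ?c"] exI[of _ "n - m"])
             (auto simp: exp_diff algebra_simps intro!: continuous_intros)
      next
        case False
        then show ?thesis using g h ex by blast
      qed
    qed note logs = this
    obtain g1 h1 and n1 :: int where 1: "continuous_on K g1" "continuous_on ?E h1"
        "\<And>w. w\<in>K \<Longrightarrow> exp (g1 w) = (w - x) / (w - z)" "\<And>w. w\<in>?E \<Longrightarrow> exp (h1 w) = (w - x) / (w - z)"
        "a \<in> K \<inter> ?E \<Longrightarrow> h1 a = g1 a" "b \<in> K \<inter> ?E \<Longrightarrow> h1 b = g1 b + 2 * of_int n1 * of_real pi * \<i>"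
      using logs[of x] same notin by blast
    obtain g2 h2 and n2 :: int where 2: "continuous_on K g2" "continuous_on ?E h2"
        "\<And>w. w\<in>K \<Longrightarrow> exp (g2 w) = (w - y) / (w - z)" "\<And>w. w\<in>?E \<Longrightarrow> exp (h2 w) = (w - y) / (w - z)"
        "a \<in> K \<inter> ?E \<Longrightarrow> h2 a = g2 a" "b \<in> K \<inter> ?E \<Longrightarrow> h2 b = g2 b + 2 * of_int n2 * of_real pi * \<i>"
      using logs[of y] same notin by blast
    have glue: "\<exists>f. continuous_on (K \<union> ?E) f \<and> (\<forall>w\<in>K. f w = g w) \<and> (\<forall>w\<in>?E. f w = h w)"
      if "continuous_on K g" "continuous_on ?E h" "a \<in> K \<inter> ?E \<Longrightarrow> h a = g a" "b \<in> K \<inter> ?E \<Longrightarrow> h b = g b"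
      for g h :: "complex \<Rightarrow> complex"
    proof -
      have eq: "g w = h w" if "w \<in> K" "w \<in> ?E" for w
        using that ends \<open>a \<in> K \<inter> ?E \<Longrightarrow> h a = g a\<close> \<open>b \<in> K \<inter> ?E \<Longrightarrow> h b = g b\<close> by auto
      have "continuous_on (K \<union> ?E) (\<lambda>w. if w \<in> K then g w else h w)"
        by (rule continuous_on_cases) (use that assms(1) cE compact_imp_closed eq in auto)
      then show ?thesis using eq by (intro exI[of _ "\<lambda>w. if w \<in> K then g w else h w"]) auto
    qed
    \<comment> \<open>Otherwise the logarithm of \<open>(w - y) / (w - z)\<close> would glue,
      against the separation of \<open>y\<close> and \<open>z\<close>.\<close>
    have "n2 \<noteq> 0"
    proof
      assume "n2 = 0"
      then obtain f where f: "continuous_on (K \<union> ?E) f" "\<forall>w\<in>K. f w = g2 w" "\<forall>w\<in>?E. f w = h2 w"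
        using glue[of g2 h2] 2 by auto
      then have "exp (f w) = (w - y) / (w - z)" if "w \<in> K \<union> ?E" for w
        using 2(3,4)[of w] that by auto
      then show False
        using not_continuous_log_quotient[OF cKE _ _ yz f(1)] notin by blast
    qed
    \<comment> \<open>At \<open>b\<close> the mismatches \<open>n2 * n1\<close> and
      \<open>n1 * n2\<close> cancel.\<close>
    have "\<exists>f. continuous_on (K \<union> ?E) f \<and> (\<forall>w\<in>K. f w = of_int n2 * g1 w - of_int n1 * g2 w) \<and>
        (\<forall>w\<in>?E. f w = of_int n2 * h1 w - of_int n1 * h2 w)"
      by (rule glue) (use 1 2 in \<open>auto simp: algebra_simps intro!: continuous_on_diff continuous_on_mult\<close>)
    then obtain f where f: "continuous_on (K \<union> ?E) f"
        "\<And>w. w \<in> K \<Longrightarrow> f w = of_int n2 * g1 w - of_int n1 * g2 w"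
        "\<And>w. w \<in> ?E \<Longrightarrow> f w = of_int n2 * h1 w - of_int n1 * h2 w"
      by blast
    define k where "k w = (w - y) powi (- n1) * (w - z) powi (n1 - n2)" for w
    have exf: "exp (f w) = (w - x) powi n2 * k w" if w: "w \<in> K \<union> ?E" for w
    proof -
      have ne: "w - x \<noteq> 0" "w - y \<noteq> 0" "w - z \<noteq> 0" using that notin by auto
      obtain p q where pq: "f w = of_int n2 * p - of_int n1 * q"
          "exp p = (w - x) / (w - z)" "exp q = (w - y) / (w - z)"
        using w f(2,3) 1(3,4) 2(3,4) by blast
      have "exp (f w) = ((w - x) / (w - z)) powi n2 / ((w - y) / (w - z)) powi n1"
        by (simp add: pq(1) exp_diff exp_power_int pq(2,3)[symmetric])
      also have "\<dots> = (w - x) powi n2 * k w"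
        using ne by (simp add: k_def power_int_divide_distrib power_int_diff power_int_minus field_simps)
      finally show ?thesis .
    qed
    have yz': "y \<notin> (K \<union> ?E) \<union> ?C x" "z \<notin> (K \<union> ?E) \<union> ?C x" using notin xy xz by auto
    show False
    proof (rule not_continuous_log_powi_bounded_component[OF cKE _ bx \<open>n2 \<noteq> 0\<close> f(1) _ _ exf])
      show "continuous_on (K \<union> ?E \<union> ?C x) k"
        unfolding k_def by (intro continuous_intros) (use yz' in auto)
      show "k w \<noteq> 0" if "w \<in> K \<union> ?E \<union> ?C x" for w
        using that yz' by (auto simp: k_def power_int_eq_0_iff)
    qed (use notin in auto)
  qed
  \<comment> \<open>At most one of the separated points lies in the unbounded component, so their
    roles can be permuted until the first one is in a bounded component.\<close>
  have "bounded (?C x) \<or> bounded (?C y)"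
  proof (rule ccontr)
    assume "\<not> ?thesis"
    then have "?C x = ?C y"
      by (intro cobounded_unique_unbounded_component) (use compact_imp_bounded[OF cKE] in auto)
    then have "y \<in> ?C x"
      using notin notK by (simp add: connected_component_refl)
    then show False using xy by simp
  qed
  then show False
    using main[of x z y] main[of y z x] main[OF same notin notK xy xz yz]
      main[OF same(2,1) notin(2,1,3) notK(2,1,3) _ yz xz] xy connected_component_sym by blast
qed


text \<open>Invariance of dimension, through the inverse of the arc. It guarantees that a face
  crossed by a new edge keeps points off that edge.\<close>

lemma interior_arc_image_empty:
  fixes \<gamma> :: "real \<Rightarrow> complex"
  assumes "arc \<gamma>"
  shows "interior (path_image \<gamma>) = {}"
proof (rule ccontr)
  assume ne: "interior (path_image \<gamma>) \<noteq> {}"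
  obtain h where h: "homeomorphism {0..1} (path_image \<gamma>) \<gamma> h"
    using homeomorphism_arc[OF assms] by blast
  have "DIM(complex) \<le> DIM(real)"
  proof (rule invariance_of_dimension[OF _ _ _ ne])
    show "continuous_on (interior (path_image \<gamma>)) h"
      using h homeomorphism_def interior_subset continuous_on_subset by metis
    show "inj_on h (interior (path_image \<gamma>))"
      by (rule inj_on_inverseI[of _ \<gamma>]) (metis h homeomorphism_apply2 interior_subset subset_iff)
  qed simp
  then show False by simp
qed

section \<open>Euler's inequality for plane graphs\<close>

definition separated_points :: "complex set \<Rightarrow> complex set \<Rightarrow> bool" where
  "separated_points K X \<longleftrightarrow>
     finite X \<and> X \<inter> K = {} \<and> (\<forall>x\<in>X. \<forall>y\<in>X. x \<noteq> y \<longrightarrow> \<not> connected_component (- K) x y)"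

text \<open>Adding \<open>E\<close> cuts only the component of \<open>m\<close>. At most one point
  of \<open>X\<close> lies there; it is replaced by \<open>Y\<close>, so the gain is at least
  \<open>card Y - 1\<close>.\<close>

lemma separated_points_refine:
  fixes K E X Y :: "complex set" and m :: complex
  assumes X: "separated_points K X" and Y: "separated_points (K \<union> E) Y"
    and U: "Y \<subseteq> connected_component_set (- K) m" "E - K \<subseteq> connected_component_set (- K) m"
  defines "Z \<equiv> (X - connected_component_set (- K) m) \<union> Y"
  shows "separated_points (K \<union> E) Z" "card X + card Y \<le> card Z + 1"
proof -
  let ?U = "connected_component_set (- K) m"
  have fin: "finite X" "finite Y" using X Y by (auto simp: separated_points_def)
  have mono: "connected_component (- K) x y" if "connected_component (- (K \<union> E)) x y" for x y
    using connected_component_of_subset[OF that] by simp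
  have XU: "\<not> connected_component (- K) x y" if "x \<in> X - ?U" "y \<in> Y" for x y
  proof
    assume "connected_component (- K) x y"
    moreover have "connected_component (- K) m y" using that U by auto
    ultimately have "connected_component (- K) m x"
      using connected_component_sym connected_component_trans by blast
    then show False using that by simp
  qed
  show "separated_points (K \<union> E) Z"
    unfolding separated_points_def
  proof (intro conjI ballI impI)
    show "finite Z" using fin by (simp add: Z_def)
    show "Z \<inter> (K \<union> E) = {}"
      using X Y U unfolding Z_def separated_points_def by blast
    fix x y assume "x \<in> Z" "y \<in> Z" "x \<noteq> y"
    then consider "x \<in> X - ?U" "y \<in> X - ?U" | "x \<in> X - ?U" "y \<in> Y" | "x \<in> Y" "y \<in> X - ?U"
      | "x \<in> Y" "y \<in> Y"
      unfolding Z_def by blast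
    then show "\<not> connected_component (- (K \<union> E)) x y"
    proof cases
      case 1
      then show ?thesis using X \<open>x \<noteq> y\<close> mono unfolding separated_points_def by blast
    next
      case 2
      then show ?thesis using XU mono by blast
    next
      case 3
      then show ?thesis using XU mono connected_component_sym by blast
    next
      case 4
      then show ?thesis using Y \<open>x \<noteq> y\<close> unfolding separated_points_def by blast
    qed
  qed
  have "card (X \<inter> ?U) \<le> Suc 0"
  proof (rule iffD2[OF card_le_Suc0_iff_eq], use fin in blast, intro ballI, rule ccontr)
    fix x y assume xy: "x \<in> X \<inter> ?U" "y \<in> X \<inter> ?U" "x \<noteq> y"
    then have "connected_component (- K) x y"
      using connected_component_sym connected_component_trans by blast
    then show False using xy X unfolding separated_points_def by blast
  qed
  moreover have "card (X - ?U) = card X - card (X \<inter> ?U)"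
    by (rule card_Diff_subset_Int) (simp add: fin)
  moreover have "card Z = card (X - ?U) + card Y"
    unfolding Z_def by (rule card_Un_disjoint) (use fin U(1) in blast)+
  moreover have "card (X \<inter> ?U) \<le> card X" using fin by (simp add: card_mono)
  ultimately show "card X + card Y \<le> card Z + 1" by linarith
qed

text \<open>Vertices are identified with their positions and an edge with its set of ends, so
  parallel edges cannot occur; arcs have distinct ends, which excludes loops.\<close>

locale plane_graph =
  fixes P :: "complex set" and Es :: "complex set set" and g :: "complex set \<Rightarrow> real \<Rightarrow> complex"
  assumes finite_points: "finite P"
    and arc_edge: "e \<in> Es \<Longrightarrow> arc (g e)"
    and edge_ends: "e \<in> Es \<Longrightarrow> {pathstart (g e), pathfinish (g e)} = e"
    and edge_points: "e \<in> Es \<Longrightarrow> path_image (g e) \<inter> P = e"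
    and edges_meet: "e \<in> Es \<Longrightarrow> e' \<in> Es \<Longrightarrow> e \<noteq> e' \<Longrightarrow> path_image (g e) \<inter> path_image (g e') \<subseteq> P"
begin

definition drawing :: "complex set set \<Rightarrow> complex set" where
  "drawing S = P \<union> (\<Union>e\<in>S. path_image (g e))"

lemma finite_edges: "finite Es"
  by (rule finite_subset[of _ "Pow P"]) (use edge_points finite_points in auto)

lemma edge_doubleton:
  assumes "e \<in> Es" "a \<in> e"
  obtains b where "e = {a, b}" "a \<noteq> b"
  using edge_ends[OF assms(1)] arc_distinct_ends[OF arc_edge[OF assms(1)]] assms(2)
  by (metis insert_commute insertE singletonD)

lemma compact_edges_image: "S \<subseteq> Es \<Longrightarrow> compact (\<Union>e\<in>S. path_image (g e))"
  using finite_edges arc_edge compact_arc_image by (meson compact_UN finite_subset subsetD)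

lemma compact_drawing: "S \<subseteq> Es \<Longrightarrow> compact (drawing S)"
  unfolding drawing_def by (intro compact_Un compact_edges_image finite_imp_compact finite_points)

lemma drawing_insert: "drawing (insert e S) = drawing S \<union> path_image (g e)"
  by (auto simp: drawing_def)

lemma edge_Int_drawing: "S \<subseteq> Es \<Longrightarrow> e \<in> Es \<Longrightarrow> e \<notin> S \<Longrightarrow> drawing S \<inter> path_image (g e) = e"
  using edge_points edges_meet unfolding drawing_def by blast

lemma edge_interior: "e \<in> Es \<Longrightarrow> path_image (g e) - e = g e ` {0<..<1}"
proof -
  assume e: "e \<in> Es"
  have inj: "inj_on (g e) {0..1}" using arc_edge[OF e] by (simp add: arc_def)
  have "e = g e ` {0, 1}" using edge_ends[OF e] by (simp add: pathstart_def pathfinish_def)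
  moreover have "path_image (g e) = g e ` {0..1}" by (simp add: path_image_def)
  moreover have "g e ` {0..1} - g e ` {0, 1} = g e ` ({0..1} - {0, 1})"
    using inj by (subst inj_on_image_set_diff[of _ "{0..1}"]) auto
  moreover have "{0..1::real} - {0, 1} = {0<..<1}" by auto
  ultimately show ?thesis by metis
qed

lemma connected_edge_interior: "e \<in> Es \<Longrightarrow> connected (path_image (g e) - e)"
  unfolding edge_interior
  by (intro connected_continuous_image continuous_on_subset[of "{0..1}" "g e" "{0<..<1}"])
     (use arc_edge in \<open>auto simp: arc_def path_def\<close>)

text \<open>
  The inequality half of Euler's formula: \<open>X\<close> represents faces and \<open>Y\<close> represents the components of
  the drawing. Points stand in for faces, so that the finiteness of the set of faces is not needed.
\<close>

lemma exists_separated_points: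
  assumes "S \<subseteq> Es" "P \<noteq> {}"
  shows "\<exists>X Y. separated_points (drawing S) X \<and> Y \<subseteq> P \<and> Y \<noteq> {} \<and>
    (\<forall>a\<in>P. \<exists>y\<in>Y. path_component (drawing S) a y) \<and> card S + 1 + card Y \<le> card X + card P"
proof -
  have "finite S" using assms finite_edges finite_subset by blast
  then show ?thesis using assms(1)
  proof (induction S rule: finite_induct)
    case empty
    obtain x where x: "x \<notin> P" using finite_points ex_new_if_finite[OF infinite_UNIV_char_0] by blast
    have "\<exists>y\<in>P. path_component (drawing {}) a y" if "a \<in> P" for a
      using that by (intro bexI[of _ a]) (auto simp: path_component_refl_eq drawing_def)
    then show ?case
      using x assms(2)
      by (intro exI[of _ "{x}"] exI[of _ P]) (auto simp: separated_points_def drawing_def)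
  next
    case (insert e S)
    then have S: "S \<subseteq> Es" and e: "e \<in> Es" "e \<notin> S" by auto
    let ?K = "drawing S" and ?E = "path_image (g e)"
    obtain X Y where X: "separated_points ?K X" and Y: "Y \<subseteq> P" "Y \<noteq> {}"
        "\<And>a. a \<in> P \<Longrightarrow> \<exists>y\<in>Y. path_component ?K a y" and count: "card S + 1 + card Y \<le> card X + card P"
      using insert.IH S by metis
    have finY: "finite Y" using Y(1) finite_points finite_subset by blast
    define a b where "a = pathstart (g e)" and "b = pathfinish (g e)"
    have ab: "a \<noteq> b" "e = {a, b}" "a \<in> P" "b \<in> P"
      using arc_distinct_ends[OF arc_edge[OF e(1)]] edge_ends[OF e(1)] edge_points[OF e(1)]
      by (auto simp: a_def b_def)
    have KE: "?K \<inter> ?E = e" using edge_Int_drawing S e by blast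
    define m where "m = g e (1/2)"
    have m: "m \<in> ?E - e" unfolding edge_interior[OF e(1)] m_def by auto
    then have mK: "m \<notin> ?K" using KE by blast
    let ?U = "connected_component_set (- ?K) m"
    \<comment> \<open>The open edge is connected and avoids the old drawing, so it lies in a single
      face \<open>?U\<close>.\<close>
    have EU: "?E - ?K \<subseteq> ?U"
    proof -
      have "?E - ?K = ?E - e" using KE by blast
      then show ?thesis
        using connected_edge_interior[OF e(1)] m KE
        by (intro connected_component_maximal) auto
    qed
    have opK: "open (- ?K)" using compact_drawing[OF S] compact_imp_closed by blast
    have opU: "open ?U" using opK by (rule open_connected_component)
    have mU: "m \<in> ?U" using mK by (simp add: connected_component_refl)
    have K': "drawing (insert e S) = ?K \<union> ?E" by (rule drawing_insert)
    have mono: "path_component (?K \<union> ?E) x y" if "path_component ?K x y" for x y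
      using that path_component_of_subset by blast
    show ?case
    proof (cases "path_component ?K a b")
      case True
      then obtain q0 where q0: "path q0" "path_image q0 \<subseteq> ?K" "pathstart q0 = a" "pathfinish q0 = b"
        unfolding path_component_def by blast
      then obtain q where q: "arc q" "path_image q \<subseteq> path_image q0" "pathstart q = a" "pathfinish q = b"
        using path_contains_arc ab(1) by metis
      \<comment> \<open>The new edge closes a cycle. Its point \<open>m\<close> is in the closure of
        both sides of the Jordan curve, so the open face \<open>?U\<close> meets both and is
        split.\<close>
      define c where "c = q +++ reversepath (g e)"
      have ar: "arc (reversepath (g e))" using arc_edge[OF e(1)] by (simp add: arc_reversepath)
      have "path_image q \<inter> ?E \<subseteq> {a, b}" using q(2) q0(2) KE ab(2) by blast
      then have simple: "simple_path c"
        unfolding c_def using q ar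
        by (intro simple_path_join_loop) (auto simp: a_def b_def)
      have loop: "pathfinish c = pathstart c" using q by (simp add: c_def a_def)
      have imc: "path_image c = path_image q \<union> ?E"
        unfolding c_def using q by (subst path_image_join) (auto simp: b_def)
      obtain inner outer where J: "open inner" "open outer" "inner \<inter> outer = {}"
          "inner \<union> outer = - path_image c" "frontier inner = path_image c" "frontier outer = path_image c"
        using Jordan_curve[OF simple loop] by metis
      have mc: "m \<in> path_image c" using m imc by auto
      have "m \<in> closure inner" "m \<in> closure outer"
        using mc J(5,6) unfolding frontier_def by blast+
      then have "?U \<inter> inner \<noteq> {}" "?U \<inter> outer \<noteq> {}"
        using open_Int_closure_eq_empty[OF opU] mU by blast+
      then obtain x1 x2 where x1: "x1 \<in> inner" "x1 \<in> ?U" and x2: "x2 \<in> outer" "x2 \<in> ?U"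
        by blast
      have cK: "path_image c \<subseteq> ?K \<union> ?E" using imc q(2) q0(2) by blast
      have UK: "?U \<inter> ?K = {}" using connected_component_subset by blast
      have xE: "x1 \<notin> ?E" "x2 \<notin> ?E" using x1 x2 J(4) imc by blast+
      have sep: "\<not> connected_component (- (?K \<union> ?E)) x1 x2"
      proof
        assume "connected_component (- (?K \<union> ?E)) x1 x2"
        then obtain T where T: "connected T" "T \<subseteq> - (?K \<union> ?E)" "x1 \<in> T" "x2 \<in> T"
          unfolding connected_component_def by blast
        then have "T \<subseteq> inner \<union> outer" using cK J(4) by blast
        then show False
          using connectedD[OF T(1) J(1,2)] J(3) T x1 x2 by blast
      qed
      then have sep12: "separated_points (?K \<union> ?E) {x1, x2}"
        unfolding separated_points_def using x1 x2 UK xE connected_component_sym by auto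
      have ne: "x1 \<noteq> x2" using x1 x2 J(3) by blast
      have sub: "{x1, x2} \<subseteq> ?U" using x1 x2 by blast
      define Z where "Z = X - ?U \<union> {x1, x2}"
      have "separated_points (?K \<union> ?E) Z" "card X + card {x1, x2} \<le> card Z + 1"
        unfolding Z_def using separated_points_refine[OF X sep12 sub EU] by blast+
      moreover have "card S + 2 + card Y \<le> card Z + card P"
        using calculation(2) ne count by simp
      moreover have "\<forall>u\<in>P. \<exists>y\<in>Y. path_component (?K \<union> ?E) u y"
        using Y(3) mono by blast
      moreover have "card (insert e S) + 1 + card Y \<le> card Z + card P"
        using calculation(3) insert.hyps by simp
      ultimately show ?thesis
        unfolding K' using Y(1,2) by blast
    next
      case False
      \<comment> \<open>Here the edge joins two components of the drawing: \<open>Y\<close> loses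
        \<open>yb\<close> and the number of faces is kept. The old representative of
        \<open>?U\<close> may lie on the new edge, so a fresh one is chosen.\<close>
      have "\<not> ?U \<subseteq> ?E"
        using interior_arc_image_empty[OF arc_edge[OF e(1)]] interior_maximal[OF _ opU] mU by blast
      then obtain x where x: "x \<in> ?U" "x \<notin> ?E" by blast
      have UK: "?U \<inter> ?K = {}" using connected_component_subset by blast
      have sepx: "separated_points (?K \<union> ?E) {x}"
        using x UK by (auto simp: separated_points_def)
      have sub: "{x} \<subseteq> ?U" using x by blast
      define Z where "Z = X - ?U \<union> {x}"
      have Z: "separated_points (?K \<union> ?E) Z" "card X + card {x} \<le> card Z + 1"
        unfolding Z_def using separated_points_refine[OF X sepx sub EU] by blast+
      obtain ya yb where y: "ya \<in> Y" "path_component ?K a ya" "yb \<in> Y" "path_component ?K b yb"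
        using Y(3) ab by blast
      have "ya \<noteq> yb" using y False path_component_sym path_component_trans by metis
      have pab: "path_component (?K \<union> ?E) a b"
        unfolding path_component_def using arc_edge[OF e(1)] arc_imp_path
        by (intro exI[of _ "g e"]) (auto simp: a_def b_def)
      have PY: "\<exists>y\<in>Y - {yb}. path_component (?K \<union> ?E) u y" if u: "u \<in> P" for u
      proof -
        obtain y where "y \<in> Y" "path_component ?K u y" using Y(3) u by blast
        moreover have "path_component (?K \<union> ?E) yb ya"
          using y pab mono path_component_sym path_component_trans by metis
        ultimately show ?thesis
          using mono path_component_trans y(1) \<open>ya \<noteq> yb\<close> by (cases "y = yb") blast+
      qed
      have "card (Y - {yb}) = card Y - 1" "card Y \<ge> 1"
        using y(3) finY card_gt_0_iff[of Y] by auto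
      then have "card (insert e S) + 1 + card (Y - {yb}) \<le> card Z + card P"
        using insert.hyps Z(2) count by simp
      moreover have "Y - {yb} \<noteq> {}" "Y - {yb} \<subseteq> P" using y Y(1) \<open>ya \<noteq> yb\<close> by blast+
      ultimately show ?thesis
        unfolding K' using PY Z(1) by blast
    qed
  qed
qed


section \<open>Face boundaries and bounds on the number of edges\<close>

text \<open>The ends are removed from the edge because many faces may touch it at a vertex alone,
  and at most two are to count.\<close>

definition face_edges :: "complex set set \<Rightarrow> complex \<Rightarrow> complex set set" where
  "face_edges S x =
     {e \<in> S. (path_image (g e) - e) \<inter> frontier (connected_component_set (- drawing S) x) \<noteq> {}}"

text \<open>Without \<open>e\<close>, every face bordering \<open>e\<close> becomes part of the face
  that contains the open edge, so three of them would be three components cut out of one by a single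
  arc.\<close>

lemma face_edges_at_most_two:
  assumes S: "S \<subseteq> Es" and e: "e \<in> S" and X: "separated_points (drawing S) X"
  shows "card {x \<in> X. e \<in> face_edges S x} \<le> 2"
proof (rule ccontr)
  assume "\<not> ?thesis"
  then have "3 \<le> card {x \<in> X. e \<in> face_edges S x}" by simp
  then obtain T where T: "T \<subseteq> {x \<in> X. e \<in> face_edges S x}" "card T = 3"
    by (metis obtain_subset_with_card_n)
  then obtain x y z where xyz: "T = {x, y, z}" "x \<noteq> y" "y \<noteq> z" "x \<noteq> z"
    unfolding card_3_iff by blast
  have eE: "e \<in> Es" using S e by blast
  let ?K = "drawing (S - {e})" and ?E = "path_image (g e)"
  have K: "drawing S = ?K \<union> ?E"
    using drawing_insert[of e "S - {e}"] e by (simp add: insert_absorb)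
  have S': "S - {e} \<subseteq> Es" using S by blast
  have KE: "?K \<inter> ?E = e" by (rule edge_Int_drawing[OF S' eE]) simp
  define m where "m = g e (1/2)"
  have m: "m \<in> ?E - e" unfolding edge_interior[OF eE] m_def by auto
  let ?U = "connected_component_set (- ?K) m"
  have EU: "?E - e \<subseteq> ?U"
    using connected_edge_interior[OF eE] m KE by (intro connected_component_maximal) auto
  have opU: "open ?U"
    using compact_drawing[OF S'] compact_imp_closed by (blast intro: open_connected_component)
  have inU: "u \<in> ?U" "u \<notin> ?E" if "u \<in> T" for u
  proof -
    let ?C = "connected_component_set (- drawing S) u"
    have "u \<in> X" "e \<in> face_edges S u" using T(1) that by auto
    then have u: "u \<notin> drawing S" using X by (auto simp: separated_points_def)
    then show "u \<notin> ?E" using K by blast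
    have "?U \<inter> closure ?C \<noteq> {}"
      using \<open>e \<in> face_edges S u\<close> EU unfolding face_edges_def frontier_def by blast
    then obtain w where w: "w \<in> ?U" "connected_component (- drawing S) u w"
      using open_Int_closure_eq_empty[OF opU] by blast
    have "connected_component (- ?K) u w"
      using connected_component_of_subset[OF w(2)] K by blast
    then show "u \<in> ?U"
      using w(1) connected_component_sym connected_component_trans by blast
  qed
  have conn: "connected_component (- ?K) u v" if "u \<in> T" "v \<in> T" for u v
    using inU(1)[OF that(1)] inU(1)[OF that(2)] connected_component_sym connected_component_trans by blast
  have sep: "\<not> connected_component (- (?K \<union> ?E)) u v" if "u \<in> T" "v \<in> T" "u \<noteq> v" for u v
    using that T(1) X unfolding separated_points_def K by blast
  obtain a b where ab: "e = {a, b}" using edge_ends[OF eE] by blast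
  show False
    by (rule complement_arc_at_most_two_components[OF compact_drawing[OF S'] arc_edge[OF eE], of a b x z y])
       (use xyz conn sep inU KE ab in auto)
qed

text \<open>The frontier of the face of \<open>x\<close> lies in the bordering edges and the
  vertices. If these edges did not separate the plane, they would not do so together with the finite
  set \<open>P\<close> either; the face, having no frontier in what remains, would then contain
  \<open>y\<close>.\<close>

lemma not_connected_complement_face_edges:
  assumes S: "S \<subseteq> Es" and x: "x \<notin> drawing S" and y: "y \<notin> drawing S"
    and sep: "\<not> connected_component (- drawing S) x y"
  shows "\<not> connected (- (\<Union>e\<in>face_edges S x. path_image (g e)))"
proof
  let ?I = "\<Union>e\<in>face_edges S x. path_image (g e)"
  let ?C = "connected_component_set (- drawing S) x"
  assume "connected (- ?I)"
  have IS: "face_edges S x \<subseteq> S" by (auto simp: face_edges_def)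
  then have "closed ?I" using compact_edges_image S by (meson compact_imp_closed order_trans)
  then have con: "connected (- ?I - P)"
    using \<open>connected (- ?I)\<close> finite_points open_Compl[OF \<open>closed ?I\<close>]
    by (intro connected_open_delete_finite) simp_all
  have sub: "- drawing S \<subseteq> - ?I - P" using IS by (auto simp: drawing_def)
  have CS: "?C \<subseteq> - drawing S" by (rule connected_component_subset)
  have clD: "closed (drawing S)" using compact_drawing[OF S] compact_imp_closed by blast
  have opC: "open ?C" using clD by (blast intro: open_connected_component)
  have "frontier ?C \<subseteq> drawing S"
    using frontier_of_connected_component_subset[of "- drawing S" x] frontier_subset_closed[OF clD] by auto
  then have fr: "frontier ?C \<inter> (- ?I - P) = {}"
  proof -
    have False if w: "w \<in> frontier ?C" "w \<notin> ?I" "w \<notin> P" for w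
    proof -
      have "w \<in> drawing S" using w \<open>frontier ?C \<subseteq> drawing S\<close> by blast
      then obtain e where e: "e \<in> S" "w \<in> path_image (g e)" using w(3) by (auto simp: drawing_def)
      then have "w \<notin> e" using w(3) edge_points S by blast
      then have "e \<in> face_edges S x" using e w(1) unfolding face_edges_def by blast
      then show False using e w(2) by blast
    qed
    then show ?thesis by blast
  qed
  have "(- ?I - P) \<subseteq> ?C"
  proof (rule ccontr)
    assume "\<not> ?thesis"
    moreover have "x \<in> (- ?I - P) \<inter> ?C"
      using x sub by (auto simp: connected_component_refl)
    ultimately have "(- ?I - P) \<inter> frontier ?C \<noteq> {}"
      using connected_Int_frontier[OF con, of ?C] by blast
    then show False using fr by blast
  qed
  then have "y \<in> ?C" using y sub by blast
  then show False using sep by simp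
qed

text \<open>A minimal separating subset works: an edge with an end of degree one in it meets the
  rest in at most one point, so by Janiszewski's theorem it could be dropped. This replaces the
  extraction of a boundary cycle.\<close>

lemma separating_edges_contain_min_degree_two:
  assumes "I \<subseteq> Es" "\<not> connected (- (\<Union>e\<in>I. path_image (g e)))"
  obtains J where "J \<subseteq> I" "J \<noteq> {}" "\<And>e a. e \<in> J \<Longrightarrow> a \<in> e \<Longrightarrow> \<exists>e'\<in>J. e' \<noteq> e \<and> a \<in> e'"
proof -
  let ?sep = "\<lambda>J. \<not> connected (- (\<Union>e\<in>J. path_image (g e)))"
  have "finite {J. J \<subseteq> I \<and> ?sep J}"
    using finite_subset[OF assms(1) finite_edges] by simp
  moreover have "{J. J \<subseteq> I \<and> ?sep J} \<noteq> {}" using assms(2) by blast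
  ultimately obtain J where J: "J \<subseteq> I" "?sep J" and
    min: "\<And>J'. J' \<subseteq> I \<Longrightarrow> ?sep J' \<Longrightarrow> J' \<subseteq> J \<Longrightarrow> J = J'"
    using finite_has_minimal[of "{J. J \<subseteq> I \<and> ?sep J}"] by auto
  have "J \<noteq> {}" using J(2) by (auto simp: connected_UNIV)
  moreover have "\<exists>e'\<in>J. e' \<noteq> e \<and> a \<in> e'" if e: "e \<in> J" and a: "a \<in> e" for e a
  proof (rule ccontr)
    assume no: "\<not> ?thesis"
    have eE: "e \<in> Es" using e J(1) assms(1) by blast
    obtain b where b: "e = {a, b}" using edge_doubleton[OF eE a] by metis
    have J': "J - {e} \<subseteq> Es" using J(1) assms(1) by blast
    let ?T = "\<Union>e'\<in>J - {e}. path_image (g e')"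
    have aT: "a \<notin> ?T"
    proof
      assume "a \<in> ?T"
      then obtain e' where "e' \<in> J" "e' \<noteq> e" "a \<in> path_image (g e')" by blast
      moreover have "a \<in> P" using a edge_points[OF eE] by blast
      ultimately have "a \<in> e'" using edge_points J(1) assms(1) by blast
      then show False using no \<open>e' \<in> J\<close> \<open>e' \<noteq> e\<close> by blast
    qed
    have "?T \<inter> path_image (g e) \<subseteq> e"
      using edge_Int_drawing[OF J' eE] unfolding drawing_def by blast
    then have "?T \<inter> path_image (g e) \<subseteq> {b}" using aT b by blast
    then have 1: "connected (?T \<inter> path_image (g e))"
      by (metis connected_empty connected_sing subset_singletonD)
    have "connected (- ?T)"
    proof (rule ccontr)
      assume "\<not> connected (- ?T)"
      then have "J = J - {e}" using min[of "J - {e}"] J(1) by blast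
      then show False using e by blast
    qed
    moreover have "connected (- path_image (g e))"
      by (rule connected_arc_complement[OF arc_edge[OF eE]]) simp
    ultimately have "connected (- (?T \<union> path_image (g e)))"
      using compact_edges_image[OF J'] compact_arc_image[OF arc_edge[OF eE]] compact_imp_closed
      by (intro Janiszewski_connected 1) auto
    moreover have "?T \<union> path_image (g e) = (\<Union>e\<in>J. path_image (g e))" using e by blast
    ultimately show False using J(2) by simp
  qed
  ultimately show ?thesis using that J(1) by blast
qed

text \<open>Stands in for the length of a cycle in a simple graph: an edge, and one further edge at
  each of its ends.\<close>

lemma card_min_degree_two_ge_3:
  assumes "J \<subseteq> Es" "J \<noteq> {}" and deg: "\<And>e a. e \<in> J \<Longrightarrow> a \<in> e \<Longrightarrow> \<exists>e'\<in>J. e' \<noteq> e \<and> a \<in> e'"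
  shows "3 \<le> card J"
proof -
  have fin: "finite J" using assms(1) finite_edges finite_subset by blast
  obtain e where e: "e \<in> J" using assms(2) by blast
  then obtain u v where uv: "e = {u, v}" "u \<noteq> v"
    using assms(1) edge_ends edge_doubleton by (metis insertI1 subsetD)
  obtain e1 where e1: "e1 \<in> J" "e1 \<noteq> e" "u \<in> e1" using deg[OF e, of u] uv by blast
  obtain e2 where e2: "e2 \<in> J" "e2 \<noteq> e" "v \<in> e2" using deg[OF e, of v] uv by blast
  obtain w where w: "e1 = {u, w}" "u \<noteq> w" using e1 assms(1) edge_doubleton by (metis subsetD)
  obtain x where x: "e2 = {v, x}" "v \<noteq> x" using e2 assms(1) edge_doubleton by (metis subsetD)
  have "w \<noteq> v" using w e1 uv by auto
  have "x \<noteq> u" using x e2 uv by auto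
  have "e1 \<noteq> e2" using w x \<open>x \<noteq> u\<close> uv(2) by auto
  then have "card {e, e1, e2} = 3" using e1 e2 by auto
  moreover have "card {e, e1, e2} \<le> card J" using fin e e1 e2 by (intro card_mono) auto
  ultimately show ?thesis by simp
qed

text \<open>The far ends \<open>w\<close> and \<open>x\<close> of the two edges next to
  \<open>e\<close> lie in different classes, so the second edge at \<open>w\<close> is a fourth
  one.\<close>

lemma card_min_degree_two_bipartite_ge_4:
  assumes "J \<subseteq> Es" "J \<noteq> {}" and deg: "\<And>e a. e \<in> J \<Longrightarrow> a \<in> e \<Longrightarrow> \<exists>e'\<in>J. e' \<noteq> e \<and> a \<in> e'"
    and bip: "\<And>e. e \<in> Es \<Longrightarrow> \<exists>u v. e = {u, v} \<and> u \<in> A \<and> v \<notin> A"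
  shows "4 \<le> card J"
proof -
  have fin: "finite J" using assms(1) finite_edges finite_subset by blast
  have bip': "(a \<in> A) \<noteq> (b \<in> A)" if "{a, b} \<in> J" for a b
    using bip[of "{a, b}"] that assms(1) by (auto simp: doubleton_eq_iff)
  obtain e where e: "e \<in> J" using assms(2) by blast
  then obtain u v where uv: "e = {u, v}" "u \<noteq> v"
    using assms(1) edge_ends edge_doubleton by (metis insertI1 subsetD)
  obtain e1 where e1: "e1 \<in> J" "e1 \<noteq> e" "u \<in> e1" using deg[OF e, of u] uv by blast
  obtain e2 where e2: "e2 \<in> J" "e2 \<noteq> e" "v \<in> e2" using deg[OF e, of v] uv by blast
  obtain w where w: "e1 = {u, w}" "u \<noteq> w" using e1 assms(1) edge_doubleton by (metis subsetD)
  obtain x where x: "e2 = {v, x}" "v \<noteq> x" using e2 assms(1) edge_doubleton by (metis subsetD)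
  obtain e3 where e3: "e3 \<in> J" "e3 \<noteq> e1" "w \<in> e3" using deg[OF e1(1), of w] w by blast
  have "w \<noteq> v" using w e1 uv by auto
  have "x \<noteq> u" using x e2 uv by auto
  have "e1 \<noteq> e2" using w x \<open>x \<noteq> u\<close> uv(2) by auto
  have "w \<noteq> x" using bip'[of u v] bip'[of u w] bip'[of v x] e e1 e2 uv w x by auto
  have "e3 \<noteq> e" using e3(3) uv(1) w(2) \<open>w \<noteq> v\<close> by auto
  moreover have "e3 \<noteq> e2" using e3(3) x(1) \<open>w \<noteq> x\<close> \<open>w \<noteq> v\<close> by auto
  ultimately have "card {e, e1, e2, e3} = 4" using e1 e2 e3 \<open>e1 \<noteq> e2\<close> by auto
  moreover have "card {e, e1, e2, e3} \<le> card J" using fin e e1 e2 e3 by (intro card_mono) auto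
  ultimately show ?thesis by simp
qed

text \<open>\<open>k\<close> plays the part of the girth. With a single point in \<open>X\<close>,
  Euler's inequality gives the forest bound; otherwise every face has at least \<open>k\<close>
  bordering edges, and double counting applies.\<close>

lemma card_edges_girth_bound:
  assumes "P \<noteq> {}"
    and girth: "\<And>J. J \<subseteq> Es \<Longrightarrow> J \<noteq> {} \<Longrightarrow>
      (\<And>e a. e \<in> J \<Longrightarrow> a \<in> e \<Longrightarrow> \<exists>e'\<in>J. e' \<noteq> e \<and> a \<in> e') \<Longrightarrow> k \<le> card J"
  shows "card Es + 1 \<le> card P \<or> k * (card Es + 2) \<le> 2 * card Es + k * card P"
proof -
  obtain X Y where X: "separated_points (drawing Es) X" and Y: "Y \<subseteq> P" "Y \<noteq> {}"
      "card Es + 1 + card Y \<le> card X + card P"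
    using exists_separated_points[OF order_refl assms(1)] by blast
  have finX: "finite X" using X by (simp add: separated_points_def)
  have "card Y > 0" using Y finite_points finite_subset card_gt_0_iff by metis
  then have count: "card Es + 2 \<le> card X + card P" using Y(3) by linarith
  show ?thesis
  proof (cases "card X \<le> 1")
    case True
    then show ?thesis using count by linarith
  next
    case False
    have "k \<le> card (face_edges Es x)" if x: "x \<in> X" for x
    proof -
      obtain y where y: "y \<in> X" "y \<noteq> x"
        using False x by (metis card_le_Suc0_iff_eq finX One_nat_def)
      have FE: "face_edges Es x \<subseteq> Es" by (auto simp: face_edges_def)
      have "\<not> connected (- (\<Union>e\<in>face_edges Es x. path_image (g e)))"
        by (rule not_connected_complement_face_edges[of _ _ y])
           (use X x y in \<open>auto simp: separated_points_def\<close>)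
      then obtain J where J: "J \<subseteq> face_edges Es x" "J \<noteq> {}"
          "\<And>e a. e \<in> J \<Longrightarrow> a \<in> e \<Longrightarrow> \<exists>e'\<in>J. e' \<noteq> e \<and> a \<in> e'"
        using separating_edges_contain_min_degree_two[OF FE] by metis
      have "k \<le> card J" using girth[OF _ J(2,3)] J(1) FE by blast
      also have "\<dots> \<le> card (face_edges Es x)"
        using J(1) FE finite_edges by (meson card_mono finite_subset)
      finally show ?thesis .
    qed
    then have "k * card X \<le> (\<Sum>x\<in>X. card (face_edges Es x))"
      using sum_bounded_below[of X k "\<lambda>x. card (face_edges Es x)"] by (simp add: mult.commute)
    also have "\<dots> = (\<Sum>x\<in>X. card {e \<in> Es. e \<in> face_edges Es x})"
      by (intro sum.cong refl arg_cong[where f = card]) (auto simp: face_edges_def)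
    also have "\<dots> = (\<Sum>e\<in>Es. card {x \<in> X. e \<in> face_edges Es x})"
      by (rule sum_multicount_gen) (use finX finite_edges in auto)
    also have "\<dots> \<le> (\<Sum>e\<in>Es. 2)"
      by (intro sum_mono face_edges_at_most_two X) auto
    finally have "k * card X \<le> 2 * card Es" by simp
    moreover have "k * (card Es + 2) \<le> k * card X + k * card P"
      using mult_le_mono2[OF count, of k] by (simp add: algebra_simps)
    ultimately show ?thesis by linarith
  qed
qed

text \<open>With two faces the constant would be 6. The constant 3 also survives the forest
  alternative, where a single vertex makes it sharp, and it is strong enough for the light edge
  argument.\<close>

theorem card_edges_le:
  assumes "P \<noteq> {}"
  shows "card Es + 3 \<le> 3 * card P"
proof -
  have "card P \<ge> 1" using assms finite_points card_gt_0_iff[of P] by simp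
  moreover have "card Es + 1 \<le> card P \<or> 3 * (card Es + 2) \<le> 2 * card Es + 3 * card P"
    by (rule card_edges_girth_bound[OF assms card_min_degree_two_ge_3])
  ultimately show ?thesis by auto
qed

theorem card_edges_bipartite_le:
  assumes "P \<noteq> {}" "\<And>e. e \<in> Es \<Longrightarrow> \<exists>u v. e = {u, v} \<and> u \<in> A \<and> v \<notin> A"
  shows "card Es + 2 \<le> 2 * card P"
proof -
  have "card P \<ge> 1" using assms finite_points card_gt_0_iff[of P] by simp
  moreover have "card Es + 1 \<le> card P \<or> 4 * (card Es + 2) \<le> 2 * card Es + 4 * card P"
    by (rule card_edges_girth_bound[OF assms(1) card_min_degree_two_bipartite_ge_4[OF _ _ _ assms(2)]])
  ultimately show ?thesis by auto
qed

end

section \<open>Light edges in planar graphs\<close>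

text \<open>Any set of edges inside \<open>W\<close> inherits the drawing; \<open>inv_into\<close>
  recovers from a pair of points the unordered edge that indexes the curve.\<close>

lemma plane_graph_of_plane_drawing:
  assumes dr: "plane_drawing G p \<gamma>" and "finite (pverts G)" and W: "W \<subseteq> pverts G"
    and F: "F \<subseteq> {{u, v} | u v. (u, v) \<in> parcs G \<and> u \<in> W \<and> v \<in> W}"
  shows "plane_graph (p ` W) ((`) p ` F) (\<lambda>e. \<gamma> (inv_into (pverts G) p ` e))"
proof
  have inj: "inj_on p (pverts G)" using dr by (simp add: plane_drawing_def)
  have inv: "inv_into (pverts G) p ` p ` f = f" if "f \<subseteq> W" for f
    using inj that W by (meson inv_into_image_cancel order_trans)
  have FW: "f \<subseteq> W" if "f \<in> F" for f using that F by blast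
  have edge: "arc (\<gamma> f) \<and> {pathstart (\<gamma> f), pathfinish (\<gamma> f)} = p ` f \<and>
      path_image (\<gamma> f) \<inter> p ` pverts G = p ` f" if f: "f \<in> F" for f
  proof -
    obtain u v where uv: "f = {u, v}" "(u, v) \<in> parcs G" using f F by blast
    have "\<forall>a\<in>parcs G. arc (\<gamma> {fst a, snd a}) \<and>
        {pathstart (\<gamma> {fst a, snd a}), pathfinish (\<gamma> {fst a, snd a})} = {p (fst a), p (snd a)} \<and>
        path_image (\<gamma> {fst a, snd a}) \<inter> p ` pverts G = {p (fst a), p (snd a)}"
      using dr unfolding plane_drawing_def case_prod_beta by (elim conjE)
    from bspec[OF this uv(2)] show ?thesis by (simp add: uv(1))
  qed
  show "finite (p ` W)" using W assms(2) finite_subset by blast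
  fix e assume e: "e \<in> (`) p ` F"
  then obtain f where f: "f \<in> F" "e = p ` f" by blast
  have g: "\<gamma> (inv_into (pverts G) p ` e) = \<gamma> f" using f inv[OF FW[OF f(1)]] by simp
  show "arc (\<gamma> (inv_into (pverts G) p ` e))"
    "{pathstart (\<gamma> (inv_into (pverts G) p ` e)), pathfinish (\<gamma> (inv_into (pverts G) p ` e))} = e"
    using edge[OF f(1)] f(2) g by auto
  show "path_image (\<gamma> (inv_into (pverts G) p ` e)) \<inter> p ` W = e"
    using conjunct2[OF conjunct2[OF edge[OF f(1)]]] f(2) FW[OF f(1)] W unfolding g by blast
  fix e' assume e': "e' \<in> (`) p ` F" "e \<noteq> e'"
  then obtain f' where f': "f' \<in> F" "e' = p ` f'" by blast
  have g': "\<gamma> (inv_into (pverts G) p ` e') = \<gamma> f'" using f' inv[OF FW[OF f'(1)]] by simp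
  have "f \<noteq> f'" using f f' e'(2) by blast
  obtain u v where uv: "f = {u, v}" "(u, v) \<in> parcs G" using f F by blast
  obtain u' v' where uv': "f' = {u', v'}" "(u', v') \<in> parcs G" using f' F by blast
  have "\<forall>a\<in>parcs G. \<forall>b\<in>parcs G. {fst a, snd a} \<noteq> {fst b, snd b} \<longrightarrow>
      path_image (\<gamma> {fst a, snd a}) \<inter> path_image (\<gamma> {fst b, snd b}) \<subseteq> p ` pverts G"
    using dr unfolding plane_drawing_def case_prod_beta by (elim conjE)
  from bspec[OF bspec[OF this uv(2)] uv'(2)]
  have "path_image (\<gamma> f) \<inter> path_image (\<gamma> f') \<subseteq> p ` pverts G"
    using uv(1) uv'(1) \<open>f \<noteq> f'\<close> by simp
  moreover have "path_image (\<gamma> f) \<inter> p ` pverts G = p ` f" using edge[OF f(1)] by simp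
  \<comment> \<open>The drawing allows curves to meet at any vertex of \<open>G\<close>, but a curve
    contains no vertices other than its ends, and those of \<open>f\<close> lie in
    \<open>W\<close>.\<close>
  ultimately have "path_image (\<gamma> f) \<inter> path_image (\<gamma> f') \<subseteq> p ` f" by blast
  then show "path_image (\<gamma> (inv_into (pverts G) p ` e)) \<inter> path_image (\<gamma> (inv_into (pverts G) p ` e')) \<subseteq> p ` W"
    using g g' FW[OF f(1)] by auto
qed

text \<open>Restricted to \<open>W\<close> because the final induction runs through induced
  subgraphs of a fixed \<open>G\<close>.\<close>

definition nbrs :: "'a pair_pre_digraph \<Rightarrow> 'a set \<Rightarrow> 'a \<Rightarrow> 'a set" where
  "nbrs G W v = {u \<in> W. (v, u) \<in> parcs G}"

lemma planar_edge_bounds: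
  assumes "pair_graph G" "planar G" and W: "W \<subseteq> pverts G" "W \<noteq> {}"
    and F: "F \<subseteq> {{u, v} | u v. (u, v) \<in> parcs G \<and> u \<in> W \<and> v \<in> W}"
  shows "card F + 3 \<le> 3 * card W"
    and "(\<And>f. f \<in> F \<Longrightarrow> \<exists>u v. f = {u, v} \<and> u \<in> A \<and> v \<in> W - A) \<Longrightarrow> card F + 2 \<le> 2 * card W"
proof -
  interpret pair_graph G by fact
  obtain p \<gamma> where dr: "plane_drawing G p \<gamma>" using assms(2) unfolding planar_def by blast
  have "inj_on p (pverts G)" using dr by (simp add: plane_drawing_def)
  then have inj: "inj_on p W" using W(1) by (rule inj_on_subset)
  interpret P: plane_graph "p ` W" "(`) p ` F" "\<lambda>e. \<gamma> (inv_into (pverts G) p ` e)"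
    by (rule plane_graph_of_plane_drawing[OF dr _ W(1) F]) simp
  have FW: "F \<subseteq> Pow W" using F by blast
  have card: "card ((`) p ` F) = card F" "card (p ` W) = card W"
    by (rule card_image[OF inj_on_subset[OF inj_on_image_Pow[OF inj] FW]], rule card_image[OF inj])
  show "card F + 3 \<le> 3 * card W"
    using P.card_edges_le W(2) card by simp
  assume bip: "\<And>f. f \<in> F \<Longrightarrow> \<exists>u v. f = {u, v} \<and> u \<in> A \<and> v \<in> W - A"
  have "\<exists>u v. e = {u, v} \<and> u \<in> p ` (A \<inter> W) \<and> v \<notin> p ` (A \<inter> W)" if e: "e \<in> (`) p ` F" for e
  proof -
    obtain f where f: "f \<in> F" "e = p ` f" using e by blast
    then obtain u v where uv: "f = {u, v}" "u \<in> A" "v \<in> W - A" using bip by blast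
    then have "u \<in> W" using f(1) FW by blast
    have "p v \<notin> p ` (A \<inter> W)" using uv inj by (auto dest: inj_onD)
    then show ?thesis using uv f(2) \<open>u \<in> W\<close> by (intro exI[of _ "p u"] exI[of _ "p v"]) auto
  qed
  then show "card F + 2 \<le> 2 * card W"
    using P.card_edges_bipartite_le[of "p ` (A \<inter> W)"] W(2) card by simp
qed

lemma card_doubleton_le: "card {x, y} \<le> 2"
  by (cases "x = y") auto

lemma sum_card_nbrs_le:
  assumes "pair_graph G" "planar G" and W: "W \<subseteq> pverts G" "W \<noteq> {}"
  shows "(\<Sum>v\<in>W. card (nbrs G W v)) + 6 \<le> 6 * card W"
proof -
  interpret pair_graph G by fact
  have finW: "finite W" using finite_subset[OF W(1) pair_finite_verts] .
  define F where "F = {{u, v} | u v. (u, v) \<in> parcs G \<and> u \<in> W \<and> v \<in> W}"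
  have finF: "finite F" by (rule finite_subset[of _ "Pow W"]) (use finW in \<open>auto simp: F_def\<close>)
  have "(\<Sum>v\<in>W. card (nbrs G W v)) = card (Sigma W (nbrs G W))"
    by (rule card_SigmaI[symmetric]) (use finW in \<open>auto simp: nbrs_def\<close>)
  also have "\<dots> \<le> card (\<Union>e\<in>F. {(u, v). e = {u, v}})"
  proof (rule card_mono)
    have "(\<Union>e\<in>F. {(u, v). e = {u, v}}) \<subseteq> W \<times> W" by (auto simp: F_def doubleton_eq_iff)
    then show "finite (\<Union>e\<in>F. {(u, v). e = {u, v}})" using finW finite_subset by blast
    show "Sigma W (nbrs G W) \<subseteq> (\<Union>e\<in>F. {(u, v). e = {u, v}})"
      unfolding nbrs_def F_def by blast
  qed
  also have "\<dots> \<le> (\<Sum>e\<in>F. card {(u, v). e = {u, v}})"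
    by (rule card_UN_le[OF finF])
  also have "\<dots> \<le> (\<Sum>e\<in>F. 2)"
  proof (rule sum_mono)
    fix e assume "e \<in> F"
    then obtain a b where ab: "e = {a, b}" unfolding F_def by blast
    have "{(u, v). e = {u, v}} \<subseteq> {(a, b), (b, a)}"
      unfolding ab by (auto simp: doubleton_eq_iff)
    then have "card {(u, v). e = {u, v}} \<le> card {(a, b), (b, a)}"
      by (rule card_mono[rotated]) simp
    moreover have "card {(a, b), (b, a)} \<le> 2" by (rule card_doubleton_le)
    ultimately show "card {(u, v). e = {u, v}} \<le> 2" by (rule order_trans)
  qed
  also have "\<dots> = 2 * card F" by simp
  finally show ?thesis
    using planar_edge_bounds(1)[OF assms, of F] unfolding F_def by simp
qed

text \<open>The second alternative is Wernicke's theorem on planar graphs of minimum degree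
  five.\<close>

theorem planar_light_edge:
  assumes "pair_graph G" "planar G" and W: "W \<subseteq> pverts G" "W \<noteq> {}"
  obtains (low) v where "v \<in> W" "card (nbrs G W v) \<le> 4"
  | (light) v w where "v \<in> W" "card (nbrs G W v) = 5" "w \<in> nbrs G W v" "card (nbrs G W w) \<le> 6"
proof (rule ccontr)
  assume "\<not> thesis"
  have min5: "5 \<le> card (nbrs G W v)" if "v \<in> W" for v
    using low[OF that] \<open>\<not> thesis\<close> by linarith
  have heavy: "7 \<le> card (nbrs G W w)" if "v \<in> W" "card (nbrs G W v) = 5" "w \<in> nbrs G W v" for v w
    using light[OF that] \<open>\<not> thesis\<close> by linarith
  interpret pair_graph G by fact
  have finW: "finite W" using finite_subset[OF W(1) pair_finite_verts] .
  define I where "I = {v \<in> W. card (nbrs G W v) = 5}"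
  define H where "H = {v \<in> W. 7 \<le> card (nbrs G W v)}"
  have IH: "I \<subseteq> W" "H \<subseteq> W" "I \<inter> H = {}" by (auto simp: I_def H_def)
  have finIH: "finite I" "finite H" 
    by (rule finite_subset[OF IH(1) finW], rule finite_subset[OF IH(2) finW])
  have "6 * card W + card H \<le> (\<Sum>v\<in>W. card (nbrs G W v)) + card I"
  proof -
    \<comment> \<open>Degrees are at least \<open>6 + 1\<close> on \<open>H\<close>, equal to
      \<open>6 - 1\<close> on \<open>I\<close> and to 6 elsewhere; the correction for
      \<open>I\<close> stands on the right to avoid subtraction of naturals.\<close>
    have "(\<Sum>v\<in>W. 6 + (if v \<in> H then 1 else 0)) \<le> (\<Sum>v\<in>W. card (nbrs G W v) + (if v \<in> I then 1 else 0))"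
      using min5 by (intro sum_mono) (force simp: I_def H_def)
    moreover have "(\<Sum>v\<in>W. if v \<in> H then 1 else 0) = card H" "(\<Sum>v\<in>W. if v \<in> I then 1 else 0) = card I"
      using finW IH by (simp_all add: sum.If_cases Int_absorb1)
    ultimately show ?thesis by (simp add: sum.distrib)
  qed
  then have HI: "card H + 6 \<le> card I" using sum_card_nbrs_le[OF assms] by linarith
  \<comment> \<open>Edges are listed from their end in \<open>I\<close>; the other end is in
    \<open>H\<close>, so each one arises once.\<close>
  define F where "F = (\<lambda>(u, v). {u, v}) ` Sigma I (nbrs G W)"
  have NH: "nbrs G W v \<subseteq> H" if "v \<in> I" for v
    using heavy[of v] that by (auto simp: I_def H_def nbrs_def)
  have "inj_on (\<lambda>(u, v). {u, v}) (Sigma I (nbrs G W))"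
    using NH IH(3) by (auto simp: inj_on_def doubleton_eq_iff)
  then have "card F = card (Sigma I (nbrs G W))" unfolding F_def by (rule card_image)
  also have "\<dots> = (\<Sum>v\<in>I. card (nbrs G W v))"
    by (rule card_SigmaI) (use finIH finW in \<open>auto simp: nbrs_def\<close>)
  also have "\<dots> = 5 * card I" by (simp add: I_def)
  finally have F5: "card F = 5 * card I" .
  have "card F + 2 \<le> 2 * card (I \<union> H)"
  proof (rule planar_edge_bounds(2)[OF assms(1,2), of "I \<union> H" F I])
    show "I \<union> H \<subseteq> pverts G" "I \<union> H \<noteq> {}" using IH W HI by auto
    show "F \<subseteq> {{u, v} |u v. (u, v) \<in> parcs G \<and> u \<in> I \<union> H \<and> v \<in> I \<union> H}"
      using NH unfolding F_def by (fastforce simp: nbrs_def)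
    show "\<exists>u v. f = {u, v} \<and> u \<in> I \<and> v \<in> I \<union> H - I" if f: "f \<in> F" for f
    proof -
      obtain u v where uv: "u \<in> I" "v \<in> nbrs G W u" "f = {u, v}" using f unfolding F_def by auto
      then have "v \<in> I \<union> H - I" using NH[OF uv(1)] IH(3) by blast
      then show ?thesis using uv by blast
    qed
  qed
  moreover have "card (I \<union> H) = card I + card H" using finIH IH(3) by (rule card_Un_disjoint)
  ultimately show False using F5 HI by linarith
qed

section \<open>Matchings\<close>

text \<open>The induction of Halmos and Vaughan: split along a tight proper subset if there is one;
  otherwise any choice for a single index preserves Hall's condition for the rest.\<close>

theorem Hall:
  fixes A :: "'i \<Rightarrow> 'c set"
  assumes "finite I" "\<And>i. i \<in> I \<Longrightarrow> finite (A i)"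
    and "\<And>J. J \<subseteq> I \<Longrightarrow> card J \<le> card (\<Union>i\<in>J. A i)"
  shows "\<exists>f. inj_on f I \<and> (\<forall>i\<in>I. f i \<in> A i)"
  using assms
proof (induction I arbitrary: A rule: finite_psubset_induct)
  case (psubset I)
  note fin = psubset.hyps(1) and finA = psubset.prems(1) and hall = psubset.prems(2)
  show ?case
  proof (cases "\<exists>J. J \<subset> I \<and> J \<noteq> {} \<and> card (\<Union>i\<in>J. A i) \<le> card J")
    case True
    then obtain J where J: "J \<subset> I" "J \<noteq> {}" "card (\<Union>i\<in>J. A i) \<le> card J" by blast
    define U where "U = (\<Union>i\<in>J. A i)"
    have finJ: "finite J" using J(1) fin finite_subset by blast
    have finU: "finite U" using finJ finA J(1) by (auto simp: U_def)
    have cU: "card U = card J" using J(3) hall[of J] J(1) by (auto simp: U_def)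
    have "\<exists>f. inj_on f J \<and> (\<forall>i\<in>J. f i \<in> A i)"
      by (rule psubset.IH[OF J(1)]) (use finA hall J(1) in auto)
    then obtain f where f: "inj_on f J" "\<And>i. i \<in> J \<Longrightarrow> f i \<in> A i" by blast
    have "\<exists>h. inj_on h (I - J) \<and> (\<forall>i\<in>I - J. h i \<in> A i - U)"
    proof (rule psubset.IH)
      show "I - J \<subset> I" using J by blast
      show "finite (A i - U)" if "i \<in> I - J" for i using that finA by blast
      fix L assume L: "L \<subseteq> I - J"
      have finL: "finite L" using L fin finite_subset by blast
      have "card L + card J = card (L \<union> J)"
        using L finL finJ by (subst card_Un_disjoint) auto
      also have "\<dots> \<le> card (\<Union>i\<in>L \<union> J. A i)" using hall[of "L \<union> J"] L J(1) by blast
      also have "(\<Union>i\<in>L \<union> J. A i) = (\<Union>i\<in>L. A i - U) \<union> U" by (auto simp: U_def)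
      also have "card \<dots> \<le> card (\<Union>i\<in>L. A i - U) + card U" by (rule card_Un_le)
      finally show "card L \<le> card (\<Union>i\<in>L. A i - U)" using cU by simp
    qed
    then obtain h where h: "inj_on h (I - J)" "\<And>i. i \<in> I - J \<Longrightarrow> h i \<in> A i - U" by blast
    have fU: "f i \<in> U" if "i \<in> J" for i using f(2)[OF that] that by (auto simp: U_def)
    define k where "k i = (if i \<in> J then f i else h i)" for i
    have "inj_on k I"
    proof (rule inj_onI)
      fix i j assume ij: "i \<in> I" "j \<in> I" "k i = k j"
      then show "i = j"
        using fU[of i] fU[of j] h(2)[of i] h(2)[of j] f(1) h(1)
        by (cases "i \<in> J"; cases "j \<in> J") (auto simp: k_def dest: inj_onD)
    qed
    moreover have "\<forall>i\<in>I. k i \<in> A i" using f(2) h(2) by (auto simp: k_def)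
    ultimately show ?thesis by blast
  next
    case False
    then have strict: "card J < card (\<Union>i\<in>J. A i)" if "J \<subset> I" "J \<noteq> {}" for J
      using that not_le by blast
    show ?thesis
    proof (cases "I = {}")
      case False
      then obtain i where i: "i \<in> I" by blast
      have "A i \<noteq> {}" using hall[of "{i}"] i by auto
      then obtain x where x: "x \<in> A i" by blast
      have "\<exists>h. inj_on h (I - {i}) \<and> (\<forall>j\<in>I - {i}. h j \<in> A j - {x})"
      proof (rule psubset.IH)
        show "I - {i} \<subset> I" using i by blast
        show "finite (A j - {x})" if "j \<in> I - {i}" for j using that finA by blast
        fix L assume L: "L \<subseteq> I - {i}"
        show "card L \<le> card (\<Union>j\<in>L. A j - {x})"
        proof (cases "L = {}")
          case False
          then have "card L < card (\<Union>j\<in>L. A j)" using strict[of L] L i by blast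
          moreover have "(\<Union>j\<in>L. A j - {x}) = (\<Union>j\<in>L. A j) - {x}" by blast
          ultimately show ?thesis by (auto simp: card_Diff_singleton_if)
        qed simp
      qed
      then obtain h where h: "inj_on h (I - {i})" "\<And>j. j \<in> I - {i} \<Longrightarrow> h j \<in> A j - {x}" by blast
      have "inj_on (h(i := x)) I"
      proof (rule inj_onI)
        fix a b assume "a \<in> I" "b \<in> I" "(h(i := x)) a = (h(i := x)) b"
        then show "a = b" using h(2)[of a] h(2)[of b] h(1)
          by (cases "a = i"; cases "b = i") (auto dest: inj_onD)
      qed
      moreover have "\<forall>j\<in>I. (h(i := x)) j \<in> A j" using h(2) x by auto
      ultimately show ?thesis by blast
    qed auto
  qed
qed

text \<open>Both sides of the bipartite graph are labelled by \<open>N\<close>, so matchings are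
  permutations and can be composed with permutations of the rows.\<close>

definition perfect_matching :: "'a set \<Rightarrow> ('a \<Rightarrow> 'a \<Rightarrow> bool) \<Rightarrow> ('a \<Rightarrow> 'a) \<Rightarrow> bool" where
  "perfect_matching N A f \<longleftrightarrow> bij_betw f N N \<and> (\<forall>i\<in>N. A i (f i))"

definition min_degree :: "nat \<Rightarrow> 'a set \<Rightarrow> ('a \<Rightarrow> 'a \<Rightarrow> bool) \<Rightarrow> bool" where
  "min_degree k N A \<longleftrightarrow> (\<forall>i\<in>N. k \<le> card {c \<in> N. A i c}) \<and> (\<forall>c\<in>N. k \<le> card {i \<in> N. A i c})"

lemma perfect_matching_if_no_deficient_set:
  assumes "finite N" "\<And>J. J \<subseteq> N \<Longrightarrow> card J \<le> card {c \<in> N. \<exists>i\<in>J. A i c}"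
  shows "\<exists>f. perfect_matching N A f"
proof -
  have "\<exists>f. inj_on f N \<and> (\<forall>i\<in>N. f i \<in> {c \<in> N. A i c})"
  proof (rule Hall)
    fix J assume "J \<subseteq> N"
    moreover have "(\<Union>i\<in>J. {c \<in> N. A i c}) = {c \<in> N. \<exists>i\<in>J. A i c}" by blast
    ultimately show "card J \<le> card (\<Union>i\<in>J. {c \<in> N. A i c})" using assms(2)[of J] by simp
  qed (use assms(1) in auto)
  then obtain f where "inj_on f N" "f ` N \<subseteq> N" "\<forall>i\<in>N. A i (f i)" by blast
  then show ?thesis
    using endo_inj_surj[OF assms(1)] unfolding perfect_matching_def bij_betw_def by blast
qed

text \<open>A set \<open>S\<close> violating Hall's condition misses many columns; \<open>T\<close>
  is trimmed so that the sizes add up to exactly \<open>card N + 1\<close>.\<close>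

lemma no_perfect_matching_rectangle:
  assumes "finite N" "\<nexists>f. perfect_matching N A f"
  obtains S T where "S \<subseteq> N" "T \<subseteq> N" "card S + card T = card N + 1" "\<And>i c. i \<in> S \<Longrightarrow> c \<in> T \<Longrightarrow> \<not> A i c"
proof -
  obtain S where S: "S \<subseteq> N" "card {c \<in> N. \<exists>i\<in>S. A i c} < card S"
    using perfect_matching_if_no_deficient_set[OF assms(1)] assms(2) not_le by metis
  let ?U = "{c \<in> N. \<exists>i\<in>S. A i c}"
  have "card S \<le> card N" using S(1) assms(1) by (rule card_mono[rotated])
  have "card (N - ?U) = card N - card ?U"
    by (rule card_Diff_subset) (use assms(1) in auto)
  then have "card N + 1 - card S \<le> card (N - ?U)" using S(2) \<open>card S \<le> card N\<close> by linarith
  then obtain T where T: "T \<subseteq> N - ?U" "card T = card N + 1 - card S"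
    by (rule obtain_subset_with_card_n)
  show ?thesis
    by (rule that[of S T]) (use S T \<open>card S \<le> card N\<close> in auto)
qed

text \<open>Any row of \<open>S\<close> has its \<open>k\<close> entries outside \<open>T\<close>,
  and dually for the columns.\<close>

lemma min_degree_rectangle:
  assumes "finite N" "min_degree k N A" "S \<subseteq> N" "T \<subseteq> N" "\<And>i c. i \<in> S \<Longrightarrow> c \<in> T \<Longrightarrow> \<not> A i c"
  shows "S \<noteq> {} \<Longrightarrow> card T + k \<le> card N" "T \<noteq> {} \<Longrightarrow> card S + k \<le> card N"
proof -
  have fin: "finite S" "finite T" using assms finite_subset by blast+
  {
    assume "S \<noteq> {}"
    then obtain i where i: "i \<in> S" by blast
    have "k \<le> card {c \<in> N. A i c}" using assms(2,3) i unfolding min_degree_def by blast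
    also have "\<dots> \<le> card (N - T)" by (rule card_mono) (use assms i in auto)
    also have "\<dots> = card N - card T" using fin assms by (intro card_Diff_subset) auto
    finally show "card T + k \<le> card N" using card_mono[OF assms(1,4)] by linarith
  next
    assume "T \<noteq> {}"
    then obtain c where c: "c \<in> T" by blast
    have "k \<le> card {i \<in> N. A i c}" using assms(2,4) c unfolding min_degree_def by blast
    also have "\<dots> \<le> card (N - S)" by (rule card_mono) (use assms c in auto)
    also have "\<dots> = card N - card S" using fin assms by (intro card_Diff_subset) auto
    finally show "card S + k \<le> card N" using card_mono[OF assms(1,3)] by linarith
  }
qed

lemma perfect_matching_if_min_degree_half:
  assumes "finite N" "min_degree k N A" "card N \<le> 2 * k"
  shows "\<exists>f. perfect_matching N A f"
proof (rule ccontr)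
  assume "\<not> ?thesis"
  then obtain S T where ST: "S \<subseteq> N" "T \<subseteq> N" "card S + card T = card N + 1"
      "\<And>i c. i \<in> S \<Longrightarrow> c \<in> T \<Longrightarrow> \<not> A i c"
    using no_perfect_matching_rectangle[OF assms(1)] by metis
  have "card S \<le> card N" "card T \<le> card N" using ST assms(1) by (auto intro: card_mono)
  then have "S \<noteq> {}" "T \<noteq> {}" using ST(3) by auto
  then show False
    using min_degree_rectangle[OF assms(1,2) ST(1,2,4)] ST(3) assms(3) by linarith
qed

lemma perfect_matching_transpose:
  assumes "perfect_matching N A f"
  shows "perfect_matching N (\<lambda>c i. A i c) (inv_into N f)"
proof -
  have bij: "bij_betw f N N" and A: "\<And>i. i \<in> N \<Longrightarrow> A i (f i)"
    using assms by (auto simp: perfect_matching_def)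
  have "A (inv_into N f c) c" if "c \<in> N" for c
    using A[of "inv_into N f c"] bij that
    by (metis bij_betw_def f_inv_into_f inv_into_into)
  then show ?thesis using bij_betw_inv_into[OF bij] by (simp add: perfect_matching_def)
qed

lemma min_degree_transpose: "min_degree k N A \<Longrightarrow> min_degree k N (\<lambda>c i. A i c)"
  by (auto simp: min_degree_def)

section \<open>Permutations along the arcs of a digraph\<close>

text \<open>Cycles of a digraph are produced as perfect matchings, with the diagonal for fixed points.\<close>

lemma permutation_through_edge:
  assumes "finite N" "E \<subseteq> N \<times> N" "(u, v) \<in> E" "(v, u) \<in> E\<^sup>*" "u \<noteq> v"
  shows "\<exists>\<pi>. bij_betw \<pi> N N \<and> (\<forall>i\<in>N. \<pi> i = i \<or> (i, \<pi> i) \<in> E) \<and> \<pi> u = v"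
proof -
  have "\<exists>f. perfect_matching N (\<lambda>i j. if i = u then j = v else i = j \<or> (i, j) \<in> E) f"
  proof (rule perfect_matching_if_no_deficient_set[OF assms(1)])
    fix J assume J: "J \<subseteq> N"
    let ?M = "{c \<in> N. \<exists>i\<in>J. if i = u then c = v else i = c \<or> (i, c) \<in> E}"
    have uv: "u \<in> N" "v \<in> N" using assms(2,3) by auto
    have finJ: "finite J" "finite ?M" using J assms(1) finite_subset by auto
    show "card J \<le> card ?M"
    proof (cases "u \<in> J")
      case False
      then have "J \<subseteq> ?M" using J by auto
      then show ?thesis using finJ by (intro card_mono)
    next
      case u: True
      have sub: "insert v (J - {u}) \<subseteq> ?M" using J u uv by auto
      have cJ: "card (J - {u}) = card J - 1" "card J > 0"
        using u finJ card_gt_0_iff[of J] by auto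
      show ?thesis
      proof (cases "v \<in> J")
        case False
        then have "card (insert v (J - {u})) = card J" using cJ finJ by simp
        then show ?thesis using card_mono[OF finJ(2) sub] by simp
      next
        case v: True
        \<comment> \<open>A shortage would need \<open>J - {u}\<close> to be closed under
          \<open>E\<close>; but it contains \<open>v\<close>, from which \<open>u\<close> is
          reachable.\<close>
        have "\<not> E `` (J - {u}) \<subseteq> J - {u}"
        proof
          assume cl: "E `` (J - {u}) \<subseteq> J - {u}"
          have "v \<in> J - {u}" using v assms(5) by blast
          then have "u \<in> E\<^sup>* `` (J - {u})" using assms(4) by blast
          then have "u \<in> J - {u}" using Image_closed_trancl[OF cl] by simp
          then show False by blast
        qed
        then obtain i j where ij: "i \<in> J - {u}" "(i, j) \<in> E" "j \<notin> J - {u}" by blast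
        then have "insert j (J - {u}) \<subseteq> ?M" using J assms(2) by auto
        moreover have "card (insert j (J - {u})) = card J" using cJ finJ ij(3) by simp
        ultimately show ?thesis using card_mono[OF finJ(2), of "insert j (J - {u})"] by simp
      qed
    qed
  qed
  then obtain f where f: "perfect_matching N (\<lambda>i j. if i = u then j = v else i = j \<or> (i, j) \<in> E) f" by blast
  have "f u = v" using f assms(2,3) unfolding perfect_matching_def by auto
  moreover have "f i = i \<or> (i, f i) \<in> E" if "i \<in> N" for i
  proof -
    have "if i = u then f i = v else i = f i \<or> (i, f i) \<in> E"
      using f that unfolding perfect_matching_def by blast
    then show ?thesis using assms(3) by (auto split: if_splits)
  qed
  ultimately show ?thesis using f unfolding perfect_matching_def by blast
qed

text \<open>A minimal nonempty closed set of reachable vertices is a terminal strong component. It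
  has a vertex other than \<open>r\<close>, which makes three together with two out-neighbours. The
  exceptional \<open>r\<close> is a vertex that may have lost an arc.\<close>

lemma reachable_cyclic_set:
  assumes "finite N" "E \<subseteq> N \<times> N" and irr: "\<And>v. (v, v) \<notin> E"
    and ne: "\<And>v. v \<in> N \<Longrightarrow> E `` {v} \<noteq> {}" and two: "\<And>v. v \<in> N \<Longrightarrow> v \<noteq> r \<Longrightarrow> 2 \<le> card (E `` {v})"
    and s: "s \<in> N"
  obtains C where "C \<subseteq> E\<^sup>+ `` {s}" "3 \<le> card C" "\<And>v. v \<in> C \<Longrightarrow> (v, v) \<in> E\<^sup>+"
proof -
  define F where "F = {C. C \<noteq> {} \<and> C \<subseteq> E\<^sup>+ `` {s} \<and> E `` C \<subseteq> C}"
  have EN: "E\<^sup>+ \<subseteq> N \<times> N" using trancl_subset_Sigma[OF assms(2)] .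
  have closed: "E `` (E\<^sup>+ `` {v}) \<subseteq> E\<^sup>+ `` {v}" for v by (auto intro: trancl_into_trancl)
  have nonempty: "E\<^sup>+ `` {v} \<noteq> {}" if "v \<in> N" for v using ne[OF that] by blast
  have finR: "finite (E\<^sup>+ `` {s})" by (rule finite_subset[OF _ assms(1)]) (use EN in blast)
  have "finite F" by (rule finite_subset[of _ "Pow (E\<^sup>+ `` {s})"]) (use finR in \<open>auto simp: F_def\<close>)
  moreover have "E\<^sup>+ `` {s} \<in> F"
    using closed[of s] nonempty[OF s] unfolding F_def by (intro CollectI conjI order_refl)
  then have "F \<noteq> {}" by (metis emptyE)
  ultimately have "\<exists>C\<in>F. \<forall>C'\<in>F. C' \<subseteq> C \<longrightarrow> C = C'"
    by (rule finite_has_minimal)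
  then obtain C where "C \<in> F" and min: "\<And>C'. C' \<in> F \<Longrightarrow> C' \<subseteq> C \<Longrightarrow> C = C'" by blast
  then have C: "C \<noteq> {}" "C \<subseteq> E\<^sup>+ `` {s}" "E `` C \<subseteq> C" by (simp_all add: F_def)
  have CN: "C \<subseteq> N" using C(2) EN by blast
  have cyc: "(v, v) \<in> E\<^sup>+" if v: "v \<in> C" for v
  proof -
    have "E\<^sup>+ `` {v} \<subseteq> E\<^sup>* `` C" using v trancl_into_rtrancl by fast
    then have sub: "E\<^sup>+ `` {v} \<subseteq> C" using Image_closed_trancl[OF C(3)] by simp
    have "E\<^sup>+ `` {v} \<in> F"
      unfolding F_def using nonempty[of v] closed[of v] sub C(2) v CN by (intro CollectI conjI) auto
    then have "C = E\<^sup>+ `` {v}" using min sub by blast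
    then show ?thesis using v by blast
  qed
  obtain w where w: "w \<in> C" "w \<noteq> r"
  proof (cases "C \<subseteq> {r}")
    case True
    then have "r \<in> C" using C(1) by blast
    then obtain w where "(r, w) \<in> E" using ne[of r] CN by blast
    then show ?thesis using that[of w] C(3) \<open>r \<in> C\<close> irr by blast
  qed (use that in blast)
  have finC: "finite C" using CN assms(1) finite_subset by blast
  have "3 \<le> card (insert w (E `` {w}))"
  proof -
    have "finite (E `` {w})" using w(1) C(3) finC by (meson Image_singleton_iff finite_subset ImageI subsetD subsetI)
    then show ?thesis using two[of w] w CN irr by (subst card_insert_disjoint) auto
  qed
  also have "\<dots> \<le> card C" by (rule card_mono[OF finC]) (use w(1) C(3) in blast)
  finally show ?thesis using that[OF C(2) _ cyc] by blast
qed

text \<open>After deleting the arc from \<open>r\<close> to \<open>r0\<close>, a vertex of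
  \<open>S\<close> on a cycle suffices. If there is none, three cyclic vertices ahead of some
  \<open>s\<close> and three behind it are distinct and outside \<open>S\<close>; this is the 6 in
  the hypothesis.\<close>

lemma permutation_moving_avoiding_edge:
  assumes "finite N" "E \<subseteq> N \<times> N" and irr: "\<And>v. (v, v) \<notin> E"
    and out2: "\<And>v. v \<in> N \<Longrightarrow> 2 \<le> card (E `` {v})" and in2: "\<And>v. v \<in> N \<Longrightarrow> 2 \<le> card (E\<inverse> `` {v})"
    and S: "S \<subseteq> N" "S \<noteq> {}" "card N < card S + 6" and "r \<noteq> r0"
  shows "\<exists>\<pi>. bij_betw \<pi> N N \<and> (\<forall>i\<in>N. \<pi> i = i \<or> (i, \<pi> i) \<in> E) \<and> (\<exists>s\<in>S. \<pi> s \<noteq> s) \<and> (r \<in> N \<longrightarrow> \<pi> r \<noteq> r0)"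
proof -
  define E' where "E' = E - {(r, r0)}"
  have E'N: "E' \<subseteq> N \<times> N" "E'\<inverse> \<subseteq> N \<times> N" using assms(2) by (auto simp: E'_def)
  have irr': "(v, v) \<notin> E'" "(v, v) \<notin> E'\<inverse>" for v using irr by (auto simp: E'_def)
  have out': "E' `` {v} \<noteq> {}" "v \<noteq> r \<Longrightarrow> 2 \<le> card (E' `` {v})" if v: "v \<in> N" for v
  proof -
    have "\<not> E `` {v} \<subseteq> {r0}" using out2[OF v] card_mono[of "{r0}" "E `` {v}"] by auto
    then show "E' `` {v} \<noteq> {}" by (auto simp: E'_def)
    assume "v \<noteq> r"
    then have "E' `` {v} = E `` {v}" by (auto simp: E'_def)
    then show "2 \<le> card (E' `` {v})" using out2[OF v] by simp
  qed
  have in': "E'\<inverse> `` {v} \<noteq> {}" "v \<noteq> r0 \<Longrightarrow> 2 \<le> card (E'\<inverse> `` {v})" if v: "v \<in> N" for v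
  proof -
    have "\<not> E\<inverse> `` {v} \<subseteq> {r}" using in2[OF v] card_mono[of "{r}" "E\<inverse> `` {v}"] by auto
    then show "E'\<inverse> `` {v} \<noteq> {}" by (auto simp: E'_def)
    assume "v \<noteq> r0"
    then have "E'\<inverse> `` {v} = E\<inverse> `` {v}" by (auto simp: E'_def)
    then show "2 \<le> card (E'\<inverse> `` {v})" using in2[OF v] by simp
  qed
  have "\<exists>s\<in>S. (s, s) \<in> E'\<^sup>+"
  proof (rule ccontr)
    assume no: "\<not> ?thesis"
    obtain s where s: "s \<in> S" "s \<in> N" using S by blast
    obtain C where C: "C \<subseteq> E'\<^sup>+ `` {s}" "3 \<le> card C" "\<And>v. v \<in> C \<Longrightarrow> (v, v) \<in> E'\<^sup>+"
      using reachable_cyclic_set[OF assms(1) E'N(1) irr'(1) out' s(2)] by metis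
    obtain C' where C': "C' \<subseteq> (E'\<inverse>)\<^sup>+ `` {s}" "3 \<le> card C'" "\<And>v. v \<in> C' \<Longrightarrow> (v, v) \<in> (E'\<inverse>)\<^sup>+"
      using reachable_cyclic_set[OF assms(1) E'N(2) irr'(2) in' s(2)] by metis
    have EN: "E'\<^sup>+ \<subseteq> N \<times> N" using trancl_subset_Sigma[OF E'N(1)] .
    have CN: "C \<subseteq> N" "C' \<subseteq> N" using C(1) C'(1) EN unfolding trancl_converse by blast+
    have fin: "finite C" "finite C'" "finite S"
      using CN S(1) assms(1) finite_subset by metis+
    have "C \<inter> C' = {}"
    proof (rule ccontr)
      assume "C \<inter> C' \<noteq> {}"
      then obtain v where "(s, v) \<in> E'\<^sup>+" "(v, s) \<in> E'\<^sup>+"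
        using C(1) C'(1) unfolding trancl_converse by blast
      then have "(s, s) \<in> E'\<^sup>+" by (rule trancl_trans)
      then show False using no s by blast
    qed
    moreover have "(C \<union> C') \<inter> S = {}"
      using C(3) C'(3) no unfolding trancl_converse by blast
    ultimately have "card (C \<union> C' \<union> S) = card C + card C' + card S"
      using fin by (simp add: card_Un_disjoint)
    moreover have "card (C \<union> C' \<union> S) \<le> card N" by (rule card_mono[OF assms(1)]) (use CN S(1) in blast)
    ultimately show False using C(2) C'(2) S(3) by linarith
  qed
  then obtain s v where s: "s \<in> S" "(s, v) \<in> E'" "(v, s) \<in> E'\<^sup>*" by (meson tranclD)
  have "s \<noteq> v" using s irr' by blast
  obtain \<pi> where \<pi>: "bij_betw \<pi> N N" "\<And>i. i \<in> N \<Longrightarrow> \<pi> i = i \<or> (i, \<pi> i) \<in> E'" "\<pi> s = v"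
    using permutation_through_edge[OF assms(1) E'N(1) s(2,3) \<open>s \<noteq> v\<close>] by blast
  have "r \<in> N \<longrightarrow> \<pi> r \<noteq> r0"
    using \<pi>(2)[of r] \<open>r \<noteq> r0\<close> by (auto simp: E'_def)
  moreover have "\<forall>i\<in>N. \<pi> i = i \<or> (i, \<pi> i) \<in> E" using \<pi>(2) by (auto simp: E'_def)
  moreover have "\<exists>s\<in>S. \<pi> s \<noteq> s" using s(1) \<pi>(3) \<open>s \<noteq> v\<close> by metis
  ultimately show ?thesis using \<pi>(1) by (intro exI[of _ \<pi>] conjI)
qed

lemma two_of_three:
  assumes "X \<subseteq> {a, b, c}" "2 \<le> card X"
  shows "a \<in> X \<and> b \<in> X \<or> a \<in> X \<and> c \<in> X \<or> b \<in> X \<and> c \<in> X"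
proof (rule ccontr)
  assume "\<not> ?thesis"
  then have "X \<subseteq> {a} \<or> X \<subseteq> {b} \<or> X \<subseteq> {c}" using assms(1) by blast
  then obtain x where "X \<subseteq> {x}" by blast
  then have "card X \<le> card {x}" by (rule card_mono[rotated]) simp
  then show False using assms(2) by simp
qed

text \<open>An arc inside \<open>S\<close> on a cycle moves both of its ends. If there is no arc
  inside \<open>S\<close>, all arcs at \<open>S\<close> lead to or from three vertices, and short
  cycles through these can be listed.\<close>

lemma permutation_moving_two:
  assumes "finite N" "E \<subseteq> N \<times> N" and irr: "\<And>v. (v, v) \<notin> E"
    and out2: "\<And>v. v \<in> N \<Longrightarrow> 2 \<le> card (E `` {v})" and in2: "\<And>v. v \<in> N \<Longrightarrow> 2 \<le> card (E\<inverse> `` {v})"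
    and S: "S \<subseteq> N" "2 \<le> card S" "card (N - S) = 3"
  shows "\<exists>\<pi>. bij_betw \<pi> N N \<and> (\<forall>i\<in>N. \<pi> i = i \<or> (i, \<pi> i) \<in> E) \<and>
    (\<exists>s\<in>S. \<exists>t\<in>S. s \<noteq> t \<and> \<pi> s \<noteq> s \<and> \<pi> t \<noteq> t)" (is "?goal")
proof (cases "E \<inter> S \<times> S = {}")
  case False
  let ?ES = "E \<inter> S \<times> S"
  have edge: ?goal if uv: "(u, v) \<in> ?ES" "(v, u) \<in> E\<^sup>*" for u v
  proof -
    have "u \<noteq> v" using uv irr by blast
    obtain \<pi> where \<pi>: "bij_betw \<pi> N N" "\<And>i. i \<in> N \<Longrightarrow> \<pi> i = i \<or> (i, \<pi> i) \<in> E" "\<pi> u = v"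
      using permutation_through_edge[OF assms(1,2) _ uv(2) \<open>u \<noteq> v\<close>] uv(1) by blast
    have "u \<in> N" "v \<in> N" using uv(1) S(1) by auto
    then have "\<pi> v \<noteq> v"
      using \<pi>(3) \<open>u \<noteq> v\<close> inj_onD[OF bij_betw_imp_inj_on[OF \<pi>(1)], of u v] by auto
    moreover have "\<pi> u \<noteq> u" using \<pi>(3) \<open>u \<noteq> v\<close> by simp
    ultimately have "\<exists>s\<in>S. \<exists>t\<in>S. s \<noteq> t \<and> \<pi> s \<noteq> s \<and> \<pi> t \<noteq> t" using uv(1) \<open>u \<noteq> v\<close> by blast
    then show ?goal using \<pi>(1,2) by (intro exI[of _ \<pi>] conjI ballI)
  qed
  have sub: "?ES\<^sup>* \<subseteq> E\<^sup>*" by (rule rtrancl_mono) blast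
  show ?goal
  proof (cases "acyclic ?ES")
    case False
    then obtain x where "(x, x) \<in> ?ES\<^sup>+" unfolding acyclic_def by blast
    then obtain y where "(x, y) \<in> ?ES" "(y, x) \<in> ?ES\<^sup>*" by (meson tranclD)
    then show ?goal using edge sub by blast
  next
    case True
    have fin: "finite ?ES" by (rule finite_subset[of _ "N \<times> N"]) (use assms(1,2) in auto)
    obtain u v where uv: "(u, v) \<in> ?ES" using False by auto
    have "wf (?ES\<inverse>)" using finite_acyclic_wf_converse[OF fin True] .
    then obtain t where t: "t \<in> ?ES\<^sup>* `` {v}" "\<And>y. (y, t) \<in> ?ES\<inverse> \<Longrightarrow> y \<notin> ?ES\<^sup>* `` {v}"
      by (rule wfE_min[of "?ES\<inverse>" v "?ES\<^sup>* `` {v}"]) auto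
    have t_sink: "(t, y) \<notin> ?ES" for y
      using t(2)[of y] rtrancl_into_rtrancl[of v t ?ES y] t(1) by auto
    have "wf ?ES" using finite_acyclic_wf[OF fin True] .
    then obtain z where z: "z \<in> (?ES\<^sup>*)\<inverse> `` {u}" "\<And>y. (y, z) \<in> ?ES \<Longrightarrow> y \<notin> (?ES\<^sup>*)\<inverse> `` {u}"
      by (rule wfE_min[of ?ES u "(?ES\<^sup>*)\<inverse> `` {u}"]) auto
    have z_source: "(y, z) \<notin> ?ES" for y
      using z(2)[of y] converse_rtrancl_into_rtrancl[of y z ?ES u] z(1) by auto
    have tS: "t \<in> S"
      using t(1) uv by (auto elim: rtranclE)
    have zS: "z \<in> S"
      using z(1) uv by (auto elim: converse_rtranclE)
    \<comment> \<open>All out-neighbours of the sink \<open>t\<close> and all in-neighbours of the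
      source \<open>z\<close> are among the three vertices outside \<open>S\<close>; two and two
      must overlap, which closes a walk through \<open>(u, v)\<close>.\<close>
    have "\<exists>x. (t, x) \<in> E \<and> (x, z) \<in> E"
    proof (rule ccontr)
      assume "\<not> ?thesis"
      then have disj: "E `` {t} \<inter> E\<inverse> `` {z} = {}" by blast
      have sub3: "E `` {t} \<union> E\<inverse> `` {z} \<subseteq> N - S"
        using t_sink z_source tS zS assms(2) by blast
      have fin3: "finite (N - S)" using assms(1) by simp
      then have "card (E `` {t} \<union> E\<inverse> `` {z}) = card (E `` {t}) + card (E\<inverse> `` {z})"
        using sub3 disj by (intro card_Un_disjoint) (auto intro: finite_subset)
      moreover have "card (E `` {t} \<union> E\<inverse> `` {z}) \<le> 3" using card_mono[OF fin3 sub3] S(3) by simp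
      moreover have "2 \<le> card (E `` {t})" using out2 tS S(1) by blast
      moreover have "2 \<le> card (E\<inverse> `` {z})" using in2 zS S(1) by blast
      ultimately show False by linarith
    qed
    then obtain x where x: "(t, x) \<in> E" "(x, z) \<in> E" by blast
    have "(v, t) \<in> E\<^sup>*" "(z, u) \<in> E\<^sup>*" using t(1) z(1) sub by blast+
    then have "(v, u) \<in> E\<^sup>*" using x by (meson rtrancl.rtrancl_into_rtrancl rtrancl_trans)
    then show ?goal using edge[OF uv] by blast
  qed
next
  case True
  obtain a b c where abc: "N - S = {a, b, c}" "a \<noteq> b" "b \<noteq> c" "a \<noteq> c"
    using S(3) unfolding card_3_iff by blast
  have perm: ?goal
    if "inj_on \<pi> N" "\<And>i. i \<in> N \<Longrightarrow> \<pi> i = i \<or> (i, \<pi> i) \<in> E" "s \<in> S" "t \<in> S" "s \<noteq> t" "\<pi> s \<noteq> s" "\<pi> t \<noteq> t" for \<pi> s t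
  proof -
    have "\<pi> ` N \<subseteq> N" using that(2) assms(2) by force
    then have "bij_betw \<pi> N N"
      using endo_inj_surj[OF assms(1) _ that(1)] that(1) by (simp add: bij_betw_def)
    moreover have "\<exists>s\<in>S. \<exists>t\<in>S. s \<noteq> t \<and> \<pi> s \<noteq> s \<and> \<pi> t \<noteq> t" using that(3-7) by blast
    ultimately show ?goal using that(2) by (intro exI[of _ \<pi>] conjI ballI)
  qed
  \<comment> \<open>Two vertices of \<open>S\<close> will be moved by a 4-cycle, by two 2-cycles or
    by a 5-cycle through \<open>a\<close>, \<open>b\<close>, \<open>c\<close>.\<close>
  have four: ?goal
    if "u \<in> S" "v \<in> S" "u \<noteq> v" "x \<in> N - S" "y \<in> N - S" "x \<noteq> y"
      "(u, x) \<in> E" "(x, v) \<in> E" "(v, y) \<in> E" "(y, u) \<in> E" for u v x y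
    by (rule perm[of "id(u := x, x := v, v := y, y := u)" u v])
       (use that in \<open>auto simp: inj_on_def split: if_splits\<close>)
  have two_two: ?goal
    if "u \<in> S" "v \<in> S" "u \<noteq> v" "x \<in> N - S" "y \<in> N - S" "x \<noteq> y"
      "(u, x) \<in> E" "(x, u) \<in> E" "(v, y) \<in> E" "(y, v) \<in> E" for u v x y
    by (rule perm[of "id(u := x, x := u, v := y, y := v)" u v])
       (use that in \<open>auto simp: inj_on_def split: if_splits\<close>)
  have five: ?goal
    if "u \<in> S" "v \<in> S" "u \<noteq> v" "x \<in> N - S" "y \<in> N - S" "z \<in> N - S" "x \<noteq> y" "x \<noteq> z" "y \<noteq> z"
      "(u, x) \<in> E" "(x, y) \<in> E" "(y, v) \<in> E" "(v, z) \<in> E" "(z, u) \<in> E" for u v x y z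
    by (rule perm[of "id(u := x, x := y, y := v, v := z, z := u)" u v])
       (use that in \<open>auto simp: inj_on_def split: if_splits\<close>)
  show ?goal
  proof (rule ccontr)
    assume no: "\<not> ?goal"
    have out3: "(u, a) \<in> E \<and> (u, b) \<in> E \<or> (u, a) \<in> E \<and> (u, c) \<in> E \<or> (u, b) \<in> E \<and> (u, c) \<in> E" if u: "u \<in> S" for u
    proof -
      have "E `` {u} \<subseteq> {a, b, c}" using True u assms(2) abc(1) by blast
      then show ?thesis using two_of_three[of "E `` {u}" a b c] out2[of u] u S(1) by auto
    qed
    have in3: "(a, u) \<in> E \<and> (b, u) \<in> E \<or> (a, u) \<in> E \<and> (c, u) \<in> E \<or> (b, u) \<in> E \<and> (c, u) \<in> E" if u: "u \<in> S" for u
    proof -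
      have "E\<inverse> `` {u} \<subseteq> {a, b, c}" using True u assms(2) abc(1) by blast
      then show ?thesis using two_of_three[of "E\<inverse> `` {u}" a b c] in2[of u] u S(1) by auto
    qed
    \<comment> \<open>The type of \<open>u\<close>: \<open>q\<close> is joined to it only outwards,
      \<open>p\<close> only inwards, \<open>r\<close> both ways. If 4-cycles and pairs of 2-cycles
      are excluded, all vertices of \<open>S\<close> share one type.\<close>
    define st where "st p q r u \<longleftrightarrow> (u, p) \<notin> E \<and> (u, q) \<in> E \<and> (u, r) \<in> E \<and>
      (p, u) \<in> E \<and> (q, u) \<notin> E \<and> (r, u) \<in> E" for p q r u
    have stuck: "st a b c u \<and> st a b c v \<or> st a c b u \<and> st a c b v \<or> st b a c u \<and> st b a c v \<or>
        st b c a u \<and> st b c a v \<or> st c a b u \<and> st c a b v \<or> st c b a u \<and> st c b a v"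
      if uv: "u \<in> S" "v \<in> S" "u \<noteq> v" for u v
    proof -
      have n: "x \<in> {a, b, c} \<Longrightarrow> y \<in> {a, b, c} \<Longrightarrow> x \<noteq> y \<Longrightarrow>
          \<not> ((u, x) \<in> E \<and> (x, v) \<in> E \<and> (v, y) \<in> E \<and> (y, u) \<in> E) \<and>
          \<not> ((u, x) \<in> E \<and> (x, u) \<in> E \<and> (v, y) \<in> E \<and> (y, v) \<in> E)" for x y
        using four[OF uv, of x y] two_two[OF uv, of x y] no abc(1) by blast
      show ?thesis
        using out3[OF uv(1)] out3[OF uv(2)] in3[OF uv(1)] in3[OF uv(2)]
          n[of a b] n[of a c] n[of b a] n[of b c] n[of c a] n[of c b] abc(2-4)
        unfolding st_def by (simp, argo)
    qed
    obtain u v where uv: "u \<in> S" "v \<in> S" "u \<noteq> v"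
      using S(2) by (metis card_le_Suc0_iff_eq card.infinite One_nat_def not_less_eq_eq numeral_2_eq_2 le_zero_eq zero_neq_numeral)
    obtain p q r where pqr: "st p q r u" "st p q r v" "{p, q, r} = {a, b, c}" "p \<noteq> q" "q \<noteq> r" "p \<noteq> r"
      using stuck[OF uv] abc(2-4) by (metis insert_commute)
    have all: "st p q r w" if w: "w \<in> S" for w
    proof (cases "w = u")
      case False
      then obtain p' q' r' where p': "st p' q' r' u" "st p' q' r' w" "{p', q', r'} = {a, b, c}" "p' \<noteq> q'" "q' \<noteq> r'" "p' \<noteq> r'"
        using stuck[OF uv(1) w] abc(2-4) by (metis insert_commute)
      have m: "p \<in> {p', q', r'}" "q \<in> {p', q', r'}" "r \<in> {p', q', r'}"
        unfolding p'(3) pqr(3)[symmetric] by simp_all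
      have "p = p'" "q = q'"
        using m(1,2) p'(1) pqr(1) unfolding st_def by auto
      moreover from this have "r = r'" using m(3) pqr(5,6) by auto
      ultimately show ?thesis using p'(2) by simp
    qed (use pqr in simp)
    have pN: "p \<in> N - S" "q \<in> N - S" "r \<in> N - S" 
      unfolding abc(1) pqr(3)[symmetric] by simp_all
    \<comment> \<open>No arc leads from \<open>q\<close> into \<open>S\<close>, so its two
      out-neighbours are \<open>p\<close> and \<open>r\<close>; the arc to \<open>p\<close>
      completes the 5-cycle.\<close>
    have "E `` {q} \<subseteq> {p, r}"
    proof
      fix w assume w: "w \<in> E `` {q}"
      then have "w \<in> N" "w \<noteq> q" using assms(2) irr by blast+
      moreover have "w \<notin> S" using all[of w] w unfolding st_def by blast
      ultimately show "w \<in> {p, r}" using abc(1) unfolding pqr(3)[symmetric] by blast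
    qed
    moreover have "\<not> E `` {q} \<subseteq> {r}"
      using out2[of q] pN card_mono[of "{r}" "E `` {q}"] by auto
    ultimately have "(q, p) \<in> E" by blast
    moreover have "(u, q) \<in> E" "(p, v) \<in> E" "(v, r) \<in> E" "(r, u) \<in> E"
      using pqr(1,2) by (simp_all add: st_def)
    ultimately show False
      using five[OF uv pN(2,1,3) pqr(4)[symmetric] pqr(5,6)] no by blast
  qed
qed

section \<open>Two disjoint matchings on eight colours\<close>

lemma card_fibre_le_1:
  assumes "inj_on f N"
  shows "card {i \<in> N. f i = c} \<le> 1"
proof -
  have "{i \<in> N. f i = c} \<subseteq> {inv_into N f c}" using assms by auto
  then have "card {i \<in> N. f i = c} \<le> card {inv_into N f c}" by (rule card_mono[rotated]) simp
  then show ?thesis by simp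
qed

lemma min_degree_remove_matching:
  assumes "finite N" "min_degree (Suc k) N A" "inj_on M N"
  shows "min_degree k N (\<lambda>i c. A i c \<and> c \<noteq> M i)"
  unfolding min_degree_def
proof (intro conjI ballI)
  fix i assume "i \<in> N"
  then have "Suc k \<le> card {c \<in> N. A i c}" using assms(2) by (simp add: min_degree_def)
  moreover have "card {c \<in> N. A i c} - 1 \<le> card ({c \<in> N. A i c} - {M i})"
    by (simp add: card_Diff_singleton_if)
  moreover have "{c \<in> N. A i c} - {M i} = {c \<in> N. A i c \<and> c \<noteq> M i}" by blast
  ultimately show "k \<le> card {c \<in> N. A i c \<and> c \<noteq> M i}" by simp
next
  fix c assume "c \<in> N"
  then have "Suc k \<le> card {i \<in> N. A i c}" using assms(2) by (simp add: min_degree_def)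
  also have "\<dots> \<le> card ({i \<in> N. A i c \<and> c \<noteq> M i} \<union> {i \<in> N. M i = c})"
    by (rule card_mono) (use assms(1) in auto)
  also have "\<dots> \<le> card {i \<in> N. A i c \<and> c \<noteq> M i} + card {i \<in> N. M i = c}" by (rule card_Un_le)
  finally show "k \<le> card {i \<in> N. A i c \<and> c \<noteq> M i}" using card_fibre_le_1[OF assms(3), of c] by simp
qed

text \<open>
  The rectangle \<open>S \<times> T\<close> violates Hall's condition for \<open>A\<close> without \<open>M0\<close>, and \<open>t0\<close> is the one column of
  \<open>T\<close> that \<open>M0\<close> does not use on \<open>S\<close>. A matching that differs from \<open>M0\<close> on \<open>S\<close> can only be blocked again
  through a poor row, of which there is at most one.
\<close>

locale blocked_matching =
  fixes N :: "'a set" and A :: "'a \<Rightarrow> 'a \<Rightarrow> bool" and M0 :: "'a \<Rightarrow> 'a" and S T :: "'a set" and t0 :: 'a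
  assumes finN: "finite N" and cardN: "card N = 8" and degA: "min_degree 4 N A"
    and bijM0: "bij_betw M0 N N"
    and S: "S \<subseteq> N" "card S = 4" and T: "T \<subseteq> N" "card T = 5"
    and blocked: "\<And>i c. i \<in> S \<Longrightarrow> c \<in> T \<Longrightarrow> A i c \<Longrightarrow> c = M0 i"
    and t0: "t0 \<in> T" "t0 \<notin> M0 ` S"
begin

lemma finST: "finite S" "finite T"
  using finite_subset[OF S(1) finN] finite_subset[OF T(1) finN] by auto

lemma injM0: "inj_on M0 N"
  using bijM0 by (simp add: bij_betw_def)

lemma column_ge_4: "c \<in> N \<Longrightarrow> 4 \<le> card {i \<in> N. A i c}"
  using degA by (simp add: min_degree_def)

text \<open>Four entries have to fit into \<open>M0 i\<close> and the three columns outside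
  \<open>T\<close>, so all of these occur.\<close>

lemma row_eq:
  assumes "i \<in> S"
  shows "{c \<in> N. A i c} = insert (M0 i) (N - T)" "M0 i \<in> T"
proof -
  have iN: "i \<in> N" using assms S(1) by blast
  have 4: "4 \<le> card {c \<in> N. A i c}" using degA iN by (simp add: min_degree_def)
  have 3: "card (N - T) = 3" using card_Diff_subset[OF finST(2) T(1)] cardN T(2) by simp
  have sub: "{c \<in> N. A i c} \<subseteq> insert (M0 i) (N - T)" using blocked[OF assms] by blast
  show MT: "M0 i \<in> T"
  proof (rule ccontr)
    assume "M0 i \<notin> T"
    then have "{c \<in> N. A i c} \<subseteq> N - T" using blocked[OF assms] by blast
    then have "card {c \<in> N. A i c} \<le> 3" using card_mono[of "N - T"] finN 3 by fastforce
    then show False using 4 by simp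
  qed
  have "card (insert (M0 i) (N - T)) = 4" using MT 3 finN by simp
  then show "{c \<in> N. A i c} = insert (M0 i) (N - T)"
    using card_seteq[OF _ sub] 4 finN by simp
qed

lemma full_outside: "i \<in> S \<Longrightarrow> c \<in> N \<Longrightarrow> c \<notin> T \<Longrightarrow> A i c"
  using row_eq(1) by blast

lemma M0_edge: "i \<in> S \<Longrightarrow> A i (M0 i)"
  using row_eq(1) by blast

text \<open>The rows outside \<open>S\<close> that can enter a new blocking rectangle, since at most
  one column of \<open>T\<close> escapes such a rectangle.\<close>

definition poor :: "'a \<Rightarrow> bool" where
  "poor r \<longleftrightarrow> r \<in> N - S \<and> card {c \<in> T - {t0}. A r c} \<le> 1"

text \<open>Two poor rows would both miss one of the four columns in \<open>T - {t0}\<close>; its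
  four entries would then have to come from the two other rows outside \<open>S\<close> and a single
  entry of \<open>M0\<close>.\<close>

lemma poor_unique:
  assumes "poor r" "poor r'"
  shows "r = r'"
proof (rule ccontr)
  assume "r \<noteq> r'"
  let ?X = "{c \<in> T - {t0}. A r c} \<union> {c \<in> T - {t0}. A r' c}"
  have "card ?X \<le> 2"
    using card_Un_le[of "{c \<in> T - {t0}. A r c}" "{c \<in> T - {t0}. A r' c}"] assms unfolding poor_def by linarith
  moreover have "card (T - {t0}) = 4" using t0(1) finST T(2) by simp
  ultimately have "\<not> T - {t0} \<subseteq> ?X" using card_mono[of ?X "T - {t0}"] finST by auto
  then obtain c where c: "c \<in> T" "\<not> A r c" "\<not> A r' c" by blast
  have "{i \<in> N. A i c} \<subseteq> (N - S - {r, r'}) \<union> {i \<in> N. M0 i = c}"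
    using c blocked by blast
  then have "card {i \<in> N. A i c} \<le> card ((N - S - {r, r'}) \<union> {i \<in> N. M0 i = c})"
    by (rule card_mono[rotated]) (use finN in simp)
  also have "\<dots> \<le> card (N - S - {r, r'}) + card {i \<in> N. M0 i = c}" by (rule card_Un_le)
  also have "card (N - S - {r, r'}) = 2"
  proof -
    have "card (N - S) = 4" using card_Diff_subset[OF finST(1) S(1)] cardN S(2) by simp
    moreover have "{r, r'} \<subseteq> N - S" using assms by (auto simp: poor_def)
    ultimately show ?thesis using \<open>r \<noteq> r'\<close> card_Diff_subset[of "{r, r'}" "N - S"] by simp
  qed
  finally have "card {i \<in> N. A i c} \<le> 3" using card_fibre_le_1[OF injM0, of c] by linarith
  then show False using column_ge_4[of c] c(1) T(1) by auto
qed

text \<open>The new blocking rectangle nearly coincides with the old one: column counts force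
  \<open>card (S \<union> S') = 5\<close>, so one row is exchanged, or one row is added and one
  column dropped. That leaves room for a single change on \<open>S\<close>, and the new row has to
  use \<open>t0\<close>.\<close>

lemma blocked_again:
  assumes bijM: "bij_betw M N N" and none: "\<nexists>f. perfect_matching N (\<lambda>i c. A i c \<and> c \<noteq> M i) f"
    and s0: "s0 \<in> S" "M s0 \<noteq> M0 s0"
  shows "\<exists>r. poor r \<and> M r = t0" and "\<And>s. s \<in> S \<Longrightarrow> M s \<noteq> M0 s \<Longrightarrow> s = s0"
proof -
  have injM: "inj_on M N" using bijM by (simp add: bij_betw_def)
  obtain S' T' where S': "S' \<subseteq> N" and T': "T' \<subseteq> N" and sum9: "card S' + card T' = 9"
    and blocked': "\<And>i c. i \<in> S' \<Longrightarrow> c \<in> T' \<Longrightarrow> A i c \<Longrightarrow> c = M i"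
    using no_perfect_matching_rectangle[OF finN none] cardN by auto
  have fin': "finite S'" "finite T'" using finite_subset[OF S' finN] finite_subset[OF T' finN] by auto
  have le8: "card S' \<le> 8" "card T' \<le> 8"
    using card_mono[OF finN S'] card_mono[OF finN T'] cardN by auto
  have deg3: "min_degree 3 N (\<lambda>i c. A i c \<and> c \<noteq> M i)"
    by (rule min_degree_remove_matching[OF finN _ injM]) (use degA in simp)
  have "S' \<noteq> {}" "T' \<noteq> {}" using sum9 le8 by auto
  then have "card T' + 3 \<le> 8" "card S' + 3 \<le> 8"
    using min_degree_rectangle[OF finN deg3 S' T'] blocked' cardN by auto
  then have sizes: "card S' = 4 \<and> card T' = 5 \<or> card S' = 5 \<and> card T' = 4" using sum9 by linarith
  let ?D = "N - (S \<union> S')"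
  have SSN: "S \<union> S' \<subseteq> N" using S S' by blast
  have finSS: "finite (S \<union> S')" using finST fin' by blast
  have cD: "card ?D + card (S \<union> S') = 8"
    using card_Diff_subset[OF finSS SSN] card_mono[OF finN SSN] cardN by linarith
  have cUI: "card (S \<union> S') + card (S \<inter> S') = 4 + card S'"
    using card_Un_Int[OF finST(1) fin'(1)] S(2) by simp
  have "card (T \<union> T') \<le> 8" using card_mono[of N "T \<union> T'"] finN T(1) T' cardN by auto
  then have "card (T \<inter> T') > 0"
    using card_Un_Int[OF finST(2) fin'(2)] T(2) sizes by linarith
  then obtain c0 where c0: "c0 \<in> T" "c0 \<in> T'" by (metis IntE card_gt_0_iff equals0I)
  \<comment> \<open>In a column shared by both rectangles the rows of \<open>S\<close> and
    \<open>S'\<close> contribute at most one entry of \<open>M0\<close> and one of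
    \<open>M\<close>.\<close>
  have "4 \<le> card ?D + 2"
  proof -
    have "{i \<in> N. A i c0} \<subseteq> ?D \<union> ({i \<in> N. M0 i = c0} \<union> {i \<in> N. M i = c0})"
      using blocked blocked' c0 by blast
    then have "card {i \<in> N. A i c0} \<le> card (?D \<union> ({i \<in> N. M0 i = c0} \<union> {i \<in> N. M i = c0}))"
      by (rule card_mono[rotated]) (use finN in simp)
    also have "\<dots> \<le> card ?D + (card {i \<in> N. M0 i = c0} + card {i \<in> N. M i = c0})"
      using card_Un_le[of ?D "{i \<in> N. M0 i = c0} \<union> {i \<in> N. M i = c0}"]
        card_Un_le[of "{i \<in> N. M0 i = c0}" "{i \<in> N. M i = c0}"] by linarith
    finally show ?thesis
      using column_ge_4[of c0] c0(1) T(1) card_fibre_le_1[OF injM0, of c0] card_fibre_le_1[OF injM, of c0]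
      by auto
  qed
  then have inter2: "2 \<le> card (S \<inter> S')" using cD cUI sizes by linarith
  \<comment> \<open>A column outside \<open>T\<close> is full on \<open>S\<close>, yet on the rows
    of \<open>S \<inter> S'\<close>, of which there are at least two, only one entry of
    \<open>M\<close> is allowed.\<close>
  have TT: "T' \<subseteq> T"
  proof
    fix q assume q: "q \<in> T'"
    show "q \<in> T"
    proof (rule ccontr)
      assume "q \<notin> T"
      then have "S \<inter> S' \<subseteq> {i \<in> N. M i = q}"
        using full_outside q T' S(1) blocked' by blast
      then have "card (S \<inter> S') \<le> card {i \<in> N. M i = q}" by (rule card_mono[rotated]) (use finN in simp)
      then show False using inter2 card_fibre_le_1[OF injM, of q] by linarith
    qed
  qed
  have cTT: "card (T - T') + card T' = 5"
    using card_Diff_subset[OF fin'(2) TT] card_mono[OF finST(2) TT] T(2) by linarith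
  have agree: "M i = M0 i" if "i \<in> S" "i \<in> S'" "M0 i \<in> T'" for i
    using blocked'[OF that(2,3) M0_edge[OF that(1)]] by simp
  obtain i0 where i0: "i0 \<in> S" "i0 \<in> S'" "M0 i0 \<in> T'"
  proof (rule ccontr)
    assume no: "\<not> thesis"
    have "M0 ` (S \<inter> S') \<subseteq> T - T'"
    proof
      fix c assume "c \<in> M0 ` (S \<inter> S')"
      then obtain i where i: "i \<in> S" "i \<in> S'" "c = M0 i" by blast
      then have "c \<notin> T'" using that no by blast
      then show "c \<in> T - T'" using row_eq(2)[OF i(1)] i(3) by blast
    qed
    moreover have "card (M0 ` (S \<inter> S')) = card (S \<inter> S')"
      by (rule card_image[OF inj_on_subset[OF injM0]]) (use S(1) in blast)
    ultimately have "card (S \<inter> S') \<le> card (T - T')"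
      using card_mono[of "T - T'" "M0 ` (S \<inter> S')"] finST by simp
    then show False using inter2 cTT sizes by linarith
  qed
  \<comment> \<open>In the column \<open>M0 i0\<close> the entries of \<open>M0\<close> and
    \<open>M\<close> coincide, which improves the count by one.\<close>
  have "4 \<le> card ?D + 1"
  proof -
    have "i = i0" if "i \<in> S" "M0 i = M0 i0" for i
      using inj_onD[OF injM0 that(2)] that(1) i0(1) S(1) by blast
    then have "{i \<in> N. A i (M0 i0)} \<subseteq> ?D \<union> {i \<in> N. M i = M0 i0}"
      using blocked[of _ "M0 i0"] blocked'[of _ "M0 i0"] row_eq(2)[OF i0(1)] i0(3) agree[OF i0] by fastforce
    then have "card {i \<in> N. A i (M0 i0)} \<le> card (?D \<union> {i \<in> N. M i = M0 i0})"
      by (rule card_mono[rotated]) (use finN in simp)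
    also have "\<dots> \<le> card ?D + card {i \<in> N. M i = M0 i0}" by (rule card_Un_le)
    finally show ?thesis
      using column_ge_4[of "M0 i0"] row_eq(2)[OF i0(1)] T(1) card_fibre_le_1[OF injM, of "M0 i0"] by auto
  qed
  then have SS5: "card (S \<union> S') \<le> 5" using cD by linarith
  have differ: "s \<in> S - S' \<or> M0 s \<in> T - T'" if "s \<in> S" "M s \<noteq> M0 s" for s
    using agree[OF that(1)] that row_eq(2)[OF that(1)] by blast
  have cS'S: "card (S' - S) + 4 = card (S \<union> S')"
  proof -
    have "S \<union> S' = S \<union> (S' - S)" by blast
    then show ?thesis using card_Un_disjoint[of S "S' - S"] finST fin' S(2) by simp
  qed
  have SS'5: "card (S \<union> S') = 5"
  proof (rule ccontr)
    assume "card (S \<union> S') \<noteq> 5"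
    then have "card (S' - S) = 0" using SS5 cS'S by linarith
    then have "S' \<subseteq> S" using fin' by auto
    then have "S' = S" by (rule card_seteq[OF finST(1)]) (use sizes S(2) in linarith)
    then have "card S' = 4" using S(2) by simp
    then have "card (T - T') = 0" using cTT sizes by linarith
    then have "T - T' = {}" using finST by simp
    then show False using differ[OF s0] \<open>S' = S\<close> by blast
  qed
  have cD3: "card ?D = 3" using cD SS'5 by simp
  have cTT1: "card (T - T') \<le> 1" using cTT sizes by linarith
  have uniq_t0: "(\<forall>s. s \<in> S \<longrightarrow> M s \<noteq> M0 s \<longrightarrow> s = s0) \<and> t0 \<in> T'"
  proof (cases "card S' = 4")
    case True
    then have "card (T - T') = 0" using cTT sizes by linarith
    then have TT0: "T - T' = {}" using finST by simp
    have "card (S - S') = 1"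
      using card_Diff_subset_Int[of S S'] finST cUI SS'5 True S(2) by simp
    then obtain x where x: "S - S' = {x}" by (rule card_1_singletonE)
    have "s \<in> S - S'" if "s \<in> S" "M s \<noteq> M0 s" for s
      using differ[OF that] unfolding TT0 by simp
    then have eq: "s = x" if "s \<in> S" "M s \<noteq> M0 s" for s using that unfolding x by blast
    have "s = s0" if "s \<in> S" "M s \<noteq> M0 s" for s using eq[OF that] eq[OF s0] by simp
    then show ?thesis using TT0 t0(1) by blast
  next
    case False
    then have "card S' = 5" using sizes by linarith
    then have "S \<union> S' = S'" using card_subset_eq[OF finSS, of S'] SS'5 by auto
    then have SsubS': "S - S' = {}" by blast
    have one: "x = y" if "x \<in> T - T'" "y \<in> T - T'" for x y
      using that cTT1 finST by (metis One_nat_def card_le_Suc0_iff_eq finite_Diff)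
    have m0: "M0 s0 \<in> T - T'" using differ[OF s0] SsubS' by blast
    have "s = s0" if "s \<in> S" "M s \<noteq> M0 s" for s
    proof -
      have "M0 s = M0 s0" using one[OF _ m0] differ[OF that] SsubS' by blast
      then show ?thesis using inj_onD[OF injM0] that(1) s0(1) S(1) by blast
    qed
    moreover have "t0 \<in> T'"
    proof (rule ccontr)
      assume "t0 \<notin> T'"
      then have "t0 = M0 s0" using one[OF _ m0] t0(1) by blast
      then show False using t0(2) s0(1) by blast
    qed
    ultimately show ?thesis by blast
  qed
  then show "\<And>s. s \<in> S \<Longrightarrow> M s \<noteq> M0 s \<Longrightarrow> s = s0" by blast
  \<comment> \<open>Column \<open>t0\<close> has no entry in \<open>S\<close> and at most three in
    \<open>?D\<close>, so a fourth one is in the new row.\<close>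
  have "\<exists>r\<in>S' - S. A r t0"
  proof (rule ccontr)
    assume "\<not> ?thesis"
    then have "{i \<in> N. A i t0} \<subseteq> ?D" using blocked[OF _ t0(1)] t0(2) by blast
    then have "card {i \<in> N. A i t0} \<le> 3" using card_mono[of ?D] finN cD3 by fastforce
    then show False using column_ge_4[of t0] t0(1) T(1) by auto
  qed
  then obtain r where r: "r \<in> S'" "r \<notin> S" "A r t0" by blast
  have Mr: "M r = t0" using blocked'[OF r(1) _ r(3)] uniq_t0 by simp
  have "{c \<in> T - {t0}. A r c} \<subseteq> T - T'" using blocked'[OF r(1)] Mr by auto
  then have "card {c \<in> T - {t0}. A r c} \<le> 1"
    using card_mono[of "T - T'" "{c \<in> T - {t0}. A r c}"] finST cTT1 by simp
  then have "poor r" using r S' by (auto simp: poor_def)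
  then show "\<exists>r. poor r \<and> M r = t0" using Mr by blast
qed

end

lemma disjoint_matchings_blocked:
  assumes "finite N" "card N = 8" "min_degree 4 N A" "min_degree 3 N B" and M0: "perfect_matching N B M0"
    and ST: "S \<subseteq> N" "card S = 4" "T \<subseteq> N" "card T = 5" "\<And>i c. i \<in> S \<Longrightarrow> c \<in> T \<Longrightarrow> A i c \<Longrightarrow> c = M0 i"
  shows "\<exists>M f. perfect_matching N B M \<and> perfect_matching N (\<lambda>i c. A i c \<and> c \<noteq> M i) f"
proof (rule ccontr)
  assume none: "\<not> ?thesis"
  have bij: "bij_betw M0 N N" and inj: "inj_on M0 N" and B0: "\<And>i. i \<in> N \<Longrightarrow> B i (M0 i)"
    using M0 by (auto simp: perfect_matching_def bij_betw_def)
  have finS: "finite S" using ST(1) assms(1) finite_subset by blast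
  have "\<not> T \<subseteq> M0 ` S"
    using card_mono[of "M0 ` S" T] card_image_le[of S M0] finS ST by auto
  then obtain t0 where t0: "t0 \<in> T" "t0 \<notin> M0 ` S" by blast
  interpret blocked_matching N A M0 S T t0
    by unfold_locales (use assms bij t0 in auto)
  obtain r0 where r0: "r0 \<in> N" "M0 r0 = t0"
    using t0(1) ST(3) bij by (metis bij_betw_def imageE subsetD)
  have r0S: "r0 \<notin> S" using r0 t0(2) by blast
  \<comment> \<open>An arc from \<open>i\<close> to \<open>j\<close> lets row \<open>i\<close> take
    over the column of \<open>j\<close>, so permutations along arcs turn \<open>M0\<close> into
    other matchings of \<open>B\<close>. Degree 3 in \<open>B\<close> leaves at least two arcs in
    each direction.\<close>
  define E where "E = {(i, j). i \<in> N \<and> j \<in> N \<and> i \<noteq> j \<and> B i (M0 j)}"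
  have EN: "E \<subseteq> N \<times> N" and irr: "\<And>v. (v, v) \<notin> E" by (auto simp: E_def)
  have deg2: "min_degree 2 N (\<lambda>i c. B i c \<and> c \<noteq> M0 i)"
    by (rule min_degree_remove_matching[OF assms(1) _ inj]) (use assms(4) in simp)
  have out2: "2 \<le> card (E `` {i})" if i: "i \<in> N" for i
  proof -
    have "{c \<in> N. B i c \<and> c \<noteq> M0 i} \<subseteq> M0 ` (E `` {i})"
    proof
      fix c assume c: "c \<in> {c \<in> N. B i c \<and> c \<noteq> M0 i}"
      then obtain j where "j \<in> N" "c = M0 j" using bij by (metis (no_types, lifting) bij_betw_def imageE mem_Collect_eq)
      then show "c \<in> M0 ` (E `` {i})" using c i by (auto simp: E_def)
    qed
    moreover have "finite (E `` {i})" by (rule finite_subset[OF _ assms(1)]) (use EN in blast)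
    ultimately have "card {c \<in> N. B i c \<and> c \<noteq> M0 i} \<le> card (E `` {i})"
      by (meson card_image_le card_mono finite_imageI le_trans)
    then show ?thesis using deg2 i unfolding min_degree_def by fastforce
  qed
  have in2: "2 \<le> card (E\<inverse> `` {j})" if j: "j \<in> N" for j
  proof -
    have "M0 j \<in> N" using bij j by (auto simp: bij_betw_def)
    then have "2 \<le> card {i \<in> N. B i (M0 j) \<and> M0 j \<noteq> M0 i}" using deg2 by (simp add: min_degree_def)
    moreover have "{i \<in> N. B i (M0 j) \<and> M0 j \<noteq> M0 i} = E\<inverse> `` {j}"
      using j inj by (auto simp: E_def dest: inj_onD)
    ultimately show ?thesis by simp
  qed
  \<comment> \<open>If \<open>M0 \<circ> \<pi>\<close> is blocked as well, a poor row has taken the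
    column of \<open>r0\<close>, and \<open>\<pi>\<close> moves only one row of \<open>S\<close>.
    Each case below chooses \<open>\<pi>\<close> against this.\<close>
  have use: "(\<exists>r. poor r \<and> \<pi> r = r0) \<and> (\<forall>s\<in>S. \<forall>s'\<in>S. \<pi> s \<noteq> s \<longrightarrow> \<pi> s' \<noteq> s' \<longrightarrow> s = s')"
    if \<pi>: "bij_betw \<pi> N N" "\<forall>i\<in>N. \<pi> i = i \<or> (i, \<pi> i) \<in> E" "s \<in> S" "\<pi> s \<noteq> s" for \<pi> s
  proof -
    have \<pi>N: "\<pi> i \<in> N" if "i \<in> N" for i using \<pi>(1) that by (auto simp: bij_betw_def)
    define M where "M = M0 \<circ> \<pi>"
    have bijM: "bij_betw M N N" unfolding M_def by (rule bij_betw_trans[OF \<pi>(1) bij])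
    have "B i (M i)" if "i \<in> N" for i
      using \<pi>(2) B0[OF that] that by (auto simp: M_def E_def)
    then have "perfect_matching N B M" using bijM by (simp add: perfect_matching_def)
    then have noM: "\<nexists>f. perfect_matching N (\<lambda>i c. A i c \<and> c \<noteq> M i) f" using none by blast
    have diff: "M i \<noteq> M0 i \<longleftrightarrow> \<pi> i \<noteq> i" if "i \<in> N" for i
      using inj_onD[OF inj, of "\<pi> i" i] \<pi>N[OF that] that by (auto simp: M_def)
    have sM: "M s \<noteq> M0 s" using diff \<pi>(3,4) S(1) by blast
    obtain r where r: "poor r" "M r = t0" using blocked_again(1)[OF bijM noM \<pi>(3) sM] by blast
    then have "\<pi> r = r0"
      using inj_onD[OF inj, of "\<pi> r" r0] r0 \<pi>N[of r] by (auto simp: M_def poor_def)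
    moreover have "x = s" if "x \<in> S" "\<pi> x \<noteq> x" for x
      using blocked_again(2)[OF bijM noM \<pi>(3) sM that(1)] diff that S(1) by blast
    ultimately show ?thesis using r(1) by blast
  qed
  show False
  proof (cases "poor r0")
    case True
    \<comment> \<open>A poor \<open>r0\<close> is the only poor row and hence fixed by
      \<open>\<pi>\<close>, so two moved rows of \<open>insert r0 S\<close> both lie in
      \<open>S\<close>.\<close>
    have c5: "card (insert r0 S) = 5" using r0S finS ST(2) by simp
    have "insert r0 S \<subseteq> N" using r0 ST(1) by blast
    then have "card (N - insert r0 S) = 3"
      using card_Diff_subset[of "insert r0 S" N] c5 finS assms(2) by simp
    then obtain \<pi> s t where \<pi>: "bij_betw \<pi> N N" "\<forall>i\<in>N. \<pi> i = i \<or> (i, \<pi> i) \<in> E"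
        and st: "s \<in> insert r0 S" "t \<in> insert r0 S" "s \<noteq> t" "\<pi> s \<noteq> s" "\<pi> t \<noteq> t"
      using permutation_moving_two[OF assms(1) EN irr out2 in2 \<open>insert r0 S \<subseteq> N\<close>] c5 by auto
    obtain x where x: "x \<in> S" "\<pi> x \<noteq> x" using st by blast
    obtain r where r: "poor r" "\<pi> r = r0" using conjunct1[OF use[OF \<pi> x]] by blast
    then have "\<pi> r0 = r0" using poor_unique[OF r(1) True] by simp
    then have "s \<in> S" "t \<in> S" using st by auto
    then show False using conjunct2[OF use[OF \<pi> x]] st(3-5) by blast
  next
    case False
    obtain x where x: "x \<in> S" using ST(2) by fastforce
    \<comment> \<open>If no row is poor, any row other than \<open>r0\<close> serves;
      \<open>x\<close> is such a default.\<close>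
    define r where "r = (if \<exists>r. poor r then (SOME r. poor r) else x)"
    have rr: "r \<noteq> r0" using False someI_ex[of poor] x r0S by (auto simp: r_def)
    have pr: "r' = r" if "poor r'" for r'
      using that someI[of poor r'] poor_unique by (auto simp: r_def)
    obtain \<pi> s where \<pi>: "bij_betw \<pi> N N" "\<forall>i\<in>N. \<pi> i = i \<or> (i, \<pi> i) \<in> E"
        and s: "s \<in> S" "\<pi> s \<noteq> s" and "r \<in> N \<longrightarrow> \<pi> r \<noteq> r0"
      using permutation_moving_avoiding_edge[OF assms(1) EN irr out2 in2 ST(1) _ _ rr] x ST(2) assms(2) by auto
    moreover obtain r' where r': "poor r'" "\<pi> r' = r0" using conjunct1[OF use[OF \<pi> s]] by blast
    ultimately show False using pr[OF r'(1)] by (simp add: poor_def)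
  qed
qed

text \<open>Removing \<open>M0\<close> leaves degree 3 in \<open>A\<close>, so the sides of a
  blocking rectangle are at most 5 and add up to 9. The 5 by 4 shape is the 4 by 5 shape with rows
  and columns exchanged.\<close>

theorem disjoint_matchings:
  assumes "finite N" "card N = 8" "min_degree 4 N A" "min_degree 3 N B" and M0: "perfect_matching N B M0"
  shows "\<exists>M f. perfect_matching N B M \<and> perfect_matching N (\<lambda>i c. A i c \<and> c \<noteq> M i) f"
proof (cases "\<exists>f. perfect_matching N (\<lambda>i c. A i c \<and> c \<noteq> M0 i) f")
  case True
  then show ?thesis using M0 by blast
next
  case False
  have bij: "bij_betw M0 N N" and inj: "inj_on M0 N"
    using M0 by (auto simp: perfect_matching_def bij_betw_def)
  obtain S T where S: "S \<subseteq> N" and T: "T \<subseteq> N" and sum9: "card S + card T = 9"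
    and blocked: "\<And>i c. i \<in> S \<Longrightarrow> c \<in> T \<Longrightarrow> A i c \<Longrightarrow> c = M0 i"
    using no_perfect_matching_rectangle[OF assms(1) False] assms(2) by auto
  have deg3: "min_degree 3 N (\<lambda>i c. A i c \<and> c \<noteq> M0 i)"
    by (rule min_degree_remove_matching[OF assms(1) _ inj]) (use assms(3) in simp)
  have "S \<noteq> {}" "T \<noteq> {}"
    using sum9 card_mono[OF assms(1) S] card_mono[OF assms(1) T] assms(2) by auto
  then have "card T + 3 \<le> 8" "card S + 3 \<le> 8"
    using min_degree_rectangle[OF assms(1) deg3 S T] blocked assms(2) by auto
  then consider "card S = 4" "card T = 5" | "card T = 4" "card S = 5" using sum9 by linarith
  then show ?thesis
  proof cases
    case 1
    then show ?thesis using disjoint_matchings_blocked[OF assms S _ T _ blocked] by blast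
  next
    case 2
    let ?A = "\<lambda>c i. A i c" and ?B = "\<lambda>c i. B i c"
    have "\<exists>M f. perfect_matching N ?B M \<and> perfect_matching N (\<lambda>c i. ?A c i \<and> i \<noteq> M c) f"
    proof (rule disjoint_matchings_blocked[OF assms(1,2) min_degree_transpose[OF assms(3)]
          min_degree_transpose[OF assms(4)] perfect_matching_transpose[OF M0] T 2(1) S 2(2)])
      fix c i assume ci: "c \<in> T" "i \<in> S" "A i c"
      then have "i \<in> N" using S by blast
      then show "i = inv_into N M0 c" using blocked[OF ci(2,1,3)] inj by (simp add: inv_into_f_f)
    qed
    then obtain M f where M: "perfect_matching N ?B M" and f: "perfect_matching N (\<lambda>c i. A i c \<and> i \<noteq> M c) f"
      by blast
    let ?M = "inv_into N M" and ?f = "inv_into N f"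
    have 1: "perfect_matching N B ?M" using perfect_matching_transpose[OF M] .
    have 2: "perfect_matching N (\<lambda>i c. A i c \<and> i \<noteq> M c) ?f" using perfect_matching_transpose[OF f] .
    have "?f i \<noteq> ?M i" if "i \<in> N" for i
    proof
      assume "?f i = ?M i"
      moreover have "M (?M i) = i"
        using M that by (metis bij_betw_def f_inv_into_f perfect_matching_def)
      ultimately show False using 2 that unfolding perfect_matching_def by metis
    qed
    then have "perfect_matching N (\<lambda>i c. A i c \<and> c \<noteq> ?M i) ?f"
      using 2 unfolding perfect_matching_def by blast
    then show ?thesis using 1 by blast
  qed
qed

section \<open>Packings\<close>

text \<open>Each \<open>u\<close> forbids one colour per index and, by injectivity, at most one
  index per colour.\<close>

lemma min_degree_avoiding:
  assumes "finite N" "finite U" and inj: "\<And>u. u \<in> U \<Longrightarrow> inj_on (h u) N" and "k + card U \<le> card N"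
  shows "min_degree k N (\<lambda>i c. \<forall>u\<in>U. h u i \<noteq> c)"
  unfolding min_degree_def
proof (intro conjI ballI)
  fix i
  have "card N \<le> card ({c \<in> N. \<forall>u\<in>U. h u i \<noteq> c} \<union> (\<lambda>u. h u i) ` U)"
    by (rule card_mono) (use assms in auto)
  also have "\<dots> \<le> card {c \<in> N. \<forall>u\<in>U. h u i \<noteq> c} + card ((\<lambda>u. h u i) ` U)" by (rule card_Un_le)
  finally show "k \<le> card {c \<in> N. \<forall>u\<in>U. h u i \<noteq> c}"
    using card_image_le[OF assms(2), of "\<lambda>u. h u i"] assms(4) by linarith
next
  fix c
  have "card N \<le> card ({i \<in> N. \<forall>u\<in>U. h u i \<noteq> c} \<union> (\<Union>u\<in>U. {i \<in> N. h u i = c}))"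
    by (rule card_mono) (use assms in auto)
  also have "\<dots> \<le> card {i \<in> N. \<forall>u\<in>U. h u i \<noteq> c} + card (\<Union>u\<in>U. {i \<in> N. h u i = c})" by (rule card_Un_le)
  finally have "card N \<le> card {i \<in> N. \<forall>u\<in>U. h u i \<noteq> c} + card (\<Union>u\<in>U. {i \<in> N. h u i = c})" .
  moreover have "card (\<Union>u\<in>U. {i \<in> N. h u i = c}) \<le> (\<Sum>u\<in>U. card {i \<in> N. h u i = c})"
    by (rule card_UN_le[OF assms(2)])
  moreover have "(\<Sum>u\<in>U. card {i \<in> N. h u i = c}) \<le> (\<Sum>u\<in>U. 1)"
    by (intro sum_mono card_fibre_le_1 inj)
  ultimately show "k \<le> card {i \<in> N. \<forall>u\<in>U. h u i \<noteq> c}" using assms(4) by simp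
qed

text \<open>
  A cover in symmetric form: \<open>\<tau> u v\<close> is the permutation attached to the edge \<open>uv\<close>, read from \<open>u\<close>
  to \<open>v\<close>. A packing is stored vertex by vertex: the \<open>i\<close>-th colouring gives \<open>v\<close> the colour \<open>\<phi> v i\<close>.
\<close>

locale symmetric_cover =
  fixes N :: "nat set" and adj :: "'a \<Rightarrow> 'a \<Rightarrow> bool" and \<tau> :: "'a \<Rightarrow> 'a \<Rightarrow> nat \<Rightarrow> nat"
  assumes finite_colours: "finite N"
    and adj_sym: "adj u v \<Longrightarrow> adj v u" and adj_irrefl: "\<not> adj v v"
    and bij: "adj u v \<Longrightarrow> bij_betw (\<tau> u v) N N"
    and inverse: "adj u v \<Longrightarrow> \<tau> v u (\<tau> u v c) = c"
begin

definition compatible :: "('a \<Rightarrow> nat \<Rightarrow> nat) \<Rightarrow> 'a \<Rightarrow> 'a \<Rightarrow> bool" where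
  "compatible \<phi> u v \<longleftrightarrow> (\<forall>i\<in>N. \<tau> u v (\<phi> u i) \<noteq> \<phi> v i)"

definition packing_on :: "'a set \<Rightarrow> ('a \<Rightarrow> nat \<Rightarrow> nat) \<Rightarrow> bool" where
  "packing_on W \<phi> \<longleftrightarrow> (\<forall>v\<in>W. bij_betw (\<phi> v) N N) \<and> (\<forall>u\<in>W. \<forall>v\<in>W. adj u v \<longrightarrow> compatible \<phi> u v)"

lemma compatible_sym: "adj u v \<Longrightarrow> compatible \<phi> u v \<Longrightarrow> compatible \<phi> v u"
  unfolding compatible_def by (metis inverse adj_sym)

lemma bij_transported:
  assumes "packing_on W \<phi>" "u \<in> W" "adj u v"
  shows "bij_betw (\<lambda>i. \<tau> u v (\<phi> u i)) N N"
proof -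
  have "bij_betw (\<phi> u) N N" using assms(1,2) by (simp add: packing_on_def)
  then have "bij_betw (\<tau> u v \<circ> \<phi> u) N N" using bij[OF assms(3)] by (rule bij_betw_trans)
  then show ?thesis by (simp add: o_def)
qed

text \<open>The neighbours block at most half of each row and column, the threshold of
  \<open>perfect_matching_if_min_degree_half\<close>.\<close>

lemma packing_extend_low_degree:
  assumes "finite W" "v \<in> W" "2 * card {u \<in> W. adj v u} \<le> card N" and \<phi>: "packing_on (W - {v}) \<phi>"
  shows "\<exists>\<phi>'. packing_on W \<phi>'"
proof -
  let ?U = "{u \<in> W. adj v u}"
  have U: "u \<in> W - {v}" "adj u v" if "u \<in> ?U" for u
    using that adj_irrefl[of v] adj_sym[of v u] by auto
  have "min_degree (card N - card ?U) N (\<lambda>i c. \<forall>u\<in>?U. \<tau> u v (\<phi> u i) \<noteq> c)"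
  proof (rule min_degree_avoiding[OF finite_colours])
    show "inj_on (\<lambda>i. \<tau> u v (\<phi> u i)) N" if "u \<in> ?U" for u
      using bij_transported[OF \<phi> U[OF that]] by (rule bij_betw_imp_inj_on)
  qed (use assms in auto)
  then obtain f where "perfect_matching N (\<lambda>i c. \<forall>u\<in>?U. \<tau> u v (\<phi> u i) \<noteq> c) f"
    using perfect_matching_if_min_degree_half[OF finite_colours] assms(3) by fastforce
  then have f: "bij_betw f N N" "\<And>i u. i \<in> N \<Longrightarrow> u \<in> ?U \<Longrightarrow> \<tau> u v (\<phi> u i) \<noteq> f i"
    by (auto simp: perfect_matching_def)
  let ?\<phi> = "\<phi>(v := f)"
  have new: "compatible ?\<phi> u v" if "u \<in> ?U" for u
    using U[OF that] f(2)[OF _ that] by (auto simp: compatible_def)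
  have "compatible ?\<phi> x y" if xy: "x \<in> W" "y \<in> W" "adj x y" for x y
  proof -
    consider "y = v" | "x = v" | "x \<noteq> v" "y \<noteq> v" by blast
    then show ?thesis
    proof cases
      case 1
      then show ?thesis using new[of x] xy adj_sym by blast
    next
      case 2
      then show ?thesis using new[of y] xy compatible_sym[OF adj_sym[OF xy(3)]] by blast
    next
      case 3
      then have "compatible \<phi> x y" using \<phi> xy by (simp add: packing_on_def)
      then show ?thesis using 3 by (simp add: compatible_def)
    qed
  qed
  moreover have "bij_betw (?\<phi> x) N N" if "x \<in> W" for x
    using that f(1) \<phi> by (auto simp: packing_on_def)
  ultimately show ?thesis unfolding packing_on_def by blast
qed

lemma packing_extend_light_edge:
  assumes "finite W" "v \<in> W" "w \<in> W" "adj v w" "card N = 8"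
    and deg_v: "card {u \<in> W. adj v u} = 5" and deg_w: "card {u \<in> W. adj w u} \<le> 6"
    and \<phi>: "packing_on (W - {v}) \<phi>"
  shows "\<exists>\<phi>'. packing_on W \<phi>'"
proof -
  let ?U = "{u \<in> W. adj v u} - {w}" and ?X = "{u \<in> W. adj w u} - {v}"
  have vw: "v \<noteq> w" "adj w v" using assms(4) adj_irrefl adj_sym by blast+
  have U: "u \<in> W - {v}" "adj u v" if "u \<in> ?U" for u
    using that adj_irrefl[of v] adj_sym[of v u] by auto
  have X: "u \<in> W - {v}" "adj u w" "u \<noteq> w" if "u \<in> ?X" for u
    using that adj_irrefl[of w] adj_sym[of w u] by auto
  have cU: "card ?U = 4" using deg_v assms(1,3,4) by (simp add: card_Diff_singleton)
  have cX: "card ?X \<le> 5" using deg_w assms(1,2) vw(2) by (simp add: card_Diff_singleton)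
  define A where "A i c \<longleftrightarrow> (\<forall>u\<in>?U. \<tau> u v (\<phi> u i) \<noteq> c)" for i c
  \<comment> \<open>\<open>B\<close> constrains \<open>w\<close> but is written in the colours of
    \<open>v\<close>; after this transport the edge condition reads \<open>f i \<noteq> M i\<close>.
    The other end of the edge is left out of both \<open>?U\<close> and \<open>?X\<close>.\<close>
  define B where "B i c \<longleftrightarrow> (\<forall>u\<in>?X. \<tau> w v (\<tau> u w (\<phi> u i)) \<noteq> c)" for i c
  have degA: "min_degree 4 N A"
    unfolding A_def
  proof (rule min_degree_avoiding[OF finite_colours])
    show "inj_on (\<lambda>i. \<tau> u v (\<phi> u i)) N" if "u \<in> ?U" for u
      using bij_transported[OF \<phi> U[OF that]] by (rule bij_betw_imp_inj_on)
  qed (use assms cU in auto)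
  have degB: "min_degree 3 N B"
    unfolding B_def
  proof (rule min_degree_avoiding[OF finite_colours])
    show "inj_on (\<lambda>i. \<tau> w v (\<tau> u w (\<phi> u i))) N" if "u \<in> ?X" for u
      using bij_betw_imp_inj_on[OF bij_betw_trans[OF bij_transported[OF \<phi> X(1,2)[OF that]] bij[OF vw(2)]]]
      by (simp add: o_def)
  qed (use assms cX in auto)
  have wW: "w \<in> W - {v}" using assms(3) vw(1) by blast
  define M0 where "M0 i = \<tau> w v (\<phi> w i)" for i
  have "perfect_matching N B M0"
    unfolding perfect_matching_def
  proof (intro conjI ballI)
    show "bij_betw M0 N N" unfolding M0_def by (rule bij_transported[OF \<phi> wW vw(2)])
    fix i assume i: "i \<in> N"
    have "\<tau> w v (\<tau> u w (\<phi> u i)) \<noteq> M0 i" if "u \<in> ?X" for u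
    proof
      assume "\<tau> w v (\<tau> u w (\<phi> u i)) = M0 i"
      then have "\<tau> u w (\<phi> u i) = \<phi> w i" unfolding M0_def by (metis inverse[OF vw(2)])
      moreover have "compatible \<phi> u w" using \<phi> X[OF that] wW by (simp add: packing_on_def)
      ultimately show False using i by (simp add: compatible_def)
    qed
    then show "B i (M0 i)" unfolding B_def by blast
  qed
  then obtain M f where M: "perfect_matching N B M" and f: "perfect_matching N (\<lambda>i c. A i c \<and> c \<noteq> M i) f"
    using disjoint_matchings[OF finite_colours assms(5) degA degB] by blast
  \<comment> \<open>Transport back turns the matching \<open>M\<close> into colours of
    \<open>w\<close>.\<close>
  let ?g = "\<lambda>i. \<tau> v w (M i)"
  let ?\<phi> = "\<phi>(w := ?g, v := f)"
  have gM: "\<tau> w v (?g i) = M i" for i using inverse[OF assms(4)] by simp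
  have wv: "compatible ?\<phi> w v"
    using f vw(1) gM by (auto simp: compatible_def perfect_matching_def)
  have Uv: "compatible ?\<phi> u v" if "u \<in> ?U" for u
    using f that U[OF that] by (auto simp: compatible_def perfect_matching_def A_def)
  have Xw: "compatible ?\<phi> u w" if "u \<in> ?X" for u
    unfolding compatible_def
  proof (intro ballI notI)
    fix i assume i: "i \<in> N" and "\<tau> u w (?\<phi> u i) = ?\<phi> w i"
    then have "\<tau> u w (\<phi> u i) = ?g i" using X[OF that] vw(1) by simp
    then have "\<tau> w v (\<tau> u w (\<phi> u i)) = M i" using gM[of i] by simp
    then show False using M i that unfolding perfect_matching_def B_def by blast
  qed
  have to_vw: "compatible ?\<phi> x y" if xy: "x \<in> W" "adj x y" and "y = v \<or> y = w \<and> x \<noteq> v" for x y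
    using that(3)
  proof
    assume "y = v"
    then show ?thesis using wv Uv[of x] xy adj_sym by (cases "x = w") auto
  next
    assume "y = w \<and> x \<noteq> v"
    then show ?thesis using Xw[of x] xy adj_sym by blast
  qed
  have "compatible ?\<phi> x y" if xy: "x \<in> W" "y \<in> W" "adj x y" for x y
  proof -
    consider "y = v \<or> y = w \<and> x \<noteq> v" | "x = v \<or> x = w \<and> y \<noteq> v" | "x \<noteq> v" "y \<noteq> v" "x \<noteq> w" "y \<noteq> w"
      by blast
    then show ?thesis
    proof cases
      case 1
      then show ?thesis using to_vw xy by blast
    next
      case 2
      then show ?thesis using to_vw[OF xy(2) adj_sym[OF xy(3)]] compatible_sym[OF adj_sym[OF xy(3)]] by blast
    next
      case 3
      then have "compatible \<phi> x y" using \<phi> xy by (simp add: packing_on_def)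
      then show ?thesis using 3 by (simp add: compatible_def)
    qed
  qed
  moreover have "bij_betw (?\<phi> x) N N" if "x \<in> W" for x
  proof -
    have "bij_betw M N N" using M by (simp add: perfect_matching_def)
    then have "bij_betw (\<tau> v w \<circ> M) N N" using bij[OF assms(4)] by (rule bij_betw_trans)
    then have g: "bij_betw ?g N N" by (simp add: o_def)
    show ?thesis using that g f \<phi> by (auto simp: packing_on_def perfect_matching_def)
  qed
  ultimately show ?thesis unfolding packing_on_def by blast
qed

end

theorem theorem1:
  fixes G :: "'a pair_pre_digraph"
  assumes "pair_graph G" and "planar G"
  shows "correspondence_packing_number G \<le> 8"
proof -
  interpret pair_graph G by fact
  have "\<exists>\<phi>. cover_packing 8 G D \<sigma> \<phi>" if cov: "cover 8 G D \<sigma>" for D \<sigma>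
  proof -
    have orient: "(u, v) \<in> D \<longleftrightarrow> (v, u) \<notin> D" if "(u, v) \<in> parcs G" for u v
      using cov that unfolding cover_def orientation_def by blast
    have DG: "D \<subseteq> parcs G" using cov unfolding cover_def orientation_def by blast
    have perm: "\<sigma> a permutes {1..8}" if "a \<in> D" for a using cov that unfolding cover_def by blast
    define \<tau> where "\<tau> u v = (if (u, v) \<in> D then \<sigma> (u, v) else inv (\<sigma> (v, u)))" for u v
    interpret C: symmetric_cover "{1..8}" "\<lambda>u v. (u, v) \<in> parcs G" \<tau>
    proof
      show "finite {1..8::nat}" by simp
      show "(v, v) \<notin> parcs G" for v using no_loops' by blast
      fix u v assume uv: "(u, v) \<in> parcs G"
      then show "(v, u) \<in> parcs G" by (rule arcs_symmetric)
      have "\<tau> u v permutes {1..8}"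
        using perm[of "(u, v)"] perm[of "(v, u)"] orient[OF uv] permutes_inv by (auto simp: \<tau>_def)
      then show "bij_betw (\<tau> u v) {1..8} {1..8}" by (rule permutes_imp_bij)
      show "\<tau> v u (\<tau> u v c) = c" for c
        using permutes_inverses[OF perm[of "(u, v)"]] permutes_inverses[OF perm[of "(v, u)"]] orient[OF uv]
        by (auto simp: \<tau>_def)
    qed
    \<comment> \<open>Only the vertex set shrinks, while \<open>G\<close> and its drawing stay
      fixed; a light edge removes just \<open>v\<close>, and \<open>w\<close> is recoloured in
      place.\<close>
    have "\<exists>\<phi>. C.packing_on W \<phi>" if "finite W" "W \<subseteq> pverts G" for W
      using that
    proof (induction W rule: finite_psubset_induct)
      case (psubset W)
      show ?case
      proof (cases "W = {}")
        case True
        then show ?thesis unfolding C.packing_on_def by blast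
      next
        case False
        have IH: "\<exists>\<phi>. C.packing_on (W - {v}) \<phi>" if "v \<in> W" for v
          by (rule psubset.IH) (use that psubset.prems in auto)
        from assms psubset.prems False show ?thesis
        proof (cases rule: planar_light_edge)
          case (low v)
          obtain \<phi> where "C.packing_on (W - {v}) \<phi>" using IH[OF low(1)] by blast
          then show ?thesis
            by (rule C.packing_extend_low_degree[OF psubset.hyps low(1), rotated])
               (use low(2) in \<open>simp add: nbrs_def\<close>)
        next
          case (light v w)
          then have w: "w \<in> W" "(v, w) \<in> parcs G" by (auto simp: nbrs_def)
          obtain \<phi> where "C.packing_on (W - {v}) \<phi>" using IH[OF light(1)] by blast
          then show ?thesis
            by (rule C.packing_extend_light_edge[OF psubset.hyps light(1) w, rotated 3])
               (use light(2,4) in \<open>simp_all add: nbrs_def\<close>)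
        qed
      qed
    qed
    from this[OF pair_finite_verts order_refl]
    obtain \<phi> where \<phi>: "C.packing_on (pverts G) \<phi>" by blast
    have bij: "bij_betw (\<phi> v) {1..8} {1..8}" if "v \<in> pverts G" for v
      using \<phi> that unfolding C.packing_on_def by blast
    have "cover_coloring 8 G D \<sigma> (\<lambda>v. \<phi> v i)" if i: "i \<in> {1..8}" for i
      unfolding cover_coloring_def
    proof (intro conjI ballI)
      show "\<phi> v i \<in> {1..8}" if "v \<in> pverts G" for v
        using bij_betwE[OF bij[OF that]] i by blast
      fix a assume a: "a \<in> D"
      obtain v w where vw: "a = (v, w)" by (cases a)
      then have arc: "(v, w) \<in> parcs G" using a DG by blast
      then have "C.compatible \<phi> v w"
        using \<phi> in_arcsD1[OF arc] in_arcsD2[OF arc] unfolding C.packing_on_def by blast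
      then have "\<tau> v w (\<phi> v i) \<noteq> \<phi> w i" using i unfolding C.compatible_def by blast
      then show "case a of (v, w) \<Rightarrow> \<sigma> (v, w) (\<phi> v i) \<noteq> \<phi> w i"
        using a vw by (simp add: \<tau>_def)
    qed
    moreover have "\<phi> v i \<noteq> \<phi> v j" if "v \<in> pverts G" "i \<in> {1..8}" "j \<in> {1..8}" "i \<noteq> j" for v i j
      using bij_betw_imp_inj_on[OF bij[OF that(1)]] that(2-4) by (auto dest: inj_onD)
    ultimately have "cover_packing 8 G D \<sigma> (\<lambda>i v. \<phi> v i)" unfolding cover_packing_def by blast
    then show ?thesis by blast
  qed
  then have "enat 8 \<in> {enat k | k. k > 0 \<and> (\<forall>D \<sigma>. cover k G D \<sigma> \<longrightarrow> (\<exists>\<phi>. cover_packing k G D \<sigma> \<phi>))}"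
    by (intro CollectI exI[of _ 8]) simp
  then have "correspondence_packing_number G \<le> enat 8"
    unfolding correspondence_packing_number_def by (rule Inf_lower)
  then show ?thesis by (simp add: numeral_eq_enat)
qed

end
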